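(* Let $G$ and $T$ be torsion-free groups, let $w=g_1t_1\cdots g_qt_q\in G*T$ be a cyclically reduced generalised unimodular word, let $t=t_1\cdots t_q$ and $R=\langle t\rangle_\infty*S\trianglelefteq T$ be as in the definition of generalised unimodularity, and let $\widehat G=\langle G,T\mid w=1\rangle=(G*T)/\langle\langle w\rangle\rangle$. Let the group $K$, the action $\phi:T\to\mathrm{Aut}\,K$, and the isomorphism $r\mapsto\bar r$ from $R\subseteq T$ onto $\bar R\subseteq K$ be those constructed in the context. Then the amalgamated semidirect product $P=T\underset{R=\bar R}{\ltimes}K$ corresponding to the action $\phi$ and the isomorphism $r\mapsto\bar r$ is isomorphic to the group $\widehat G$. The isomorphism $P\to\widehat G$ is the identity on $T$ and maps the subgroup $G^{(1)}\subseteq P$ onto $G\subseteq\widehat G$ and the subgroup $K\trianglelefteq P$ onto $\langle\langle G,S\rangle\rangle=\langle\langle G,R\rangle\rangle\trianglelefteq\widehat G$.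
   Context: Conventions: $x^y=y^{-1}xy$; the image of $x$ under a homomorphism $\phi$ is written $x^\phi$, and $b^{x^\phi}$ is the image of $b$ under the automorphism $x^\phi$; $\langle\langle X\rangle\rangle$ is the normal closure of $X$. "Cyclically reduced" means that either $q=1$ or all $g_i\neq1$ and all $t_i\ne1$ ($g_i\in G$, $t_i\in T$). Strong UP property: a group $H$ has it if for any two finite nonempty subsets $X,Y\subseteq H$ with $|Y|\ge2$, the product $XY$ contains at least two elements $x_1y_1$, $x_2y_2$ ($x_i\in X$, $y_i\in Y$), each decomposing uniquely into a product of an element of $X$ and an element of $Y$, with $y_1\neq y_2$. Generalised unimodular: $w=g_1t_1\cdots g_qt_q\in G*T$ is generalised unimodular if (1) $t=t_1\cdots t_q\ne1$ and $T$ is torsion-free; (2) the cyclic subgroup $\langle t\rangle$ is a free factor of some normal subgroup $R=\langle t\rangle*S$ of $T$; (3) $T/R$ has the strong UP property. Amalgamated semidirect product: let a group $A$ act on a group $B$ by automorphisms $\phi:A\to\mathrm{Aut}\,B$ (right action), let $N\trianglelefteq A$, and let $\psi:N\to N^\psi\subseteq B$ be an isomorphism onto a subgroup of $B$ consistent with the action, i.e. $(n^a)^\psi=(n^\psi)^{a^\phi}$ and $b^{n^\phi}=b^{n^\psi}$ for all $a\in A$, $b\in B$, $n\in N$. Let $A\ltimes B$ be the semidirect product, consisting of formal products $ab$ with $(ab)(a_1b_1)=(aa_1)(b^{a_1^\phi}b_1)$. The elements $n(n^{\psi})^{-1}$, $n\in N$, form a normal subgroup, and $A\underset{N=N^\psi}{\ltimes}B$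 is the quotient of $A\ltimes B$ by this subgroup. It contains $A$ and $B$ as subgroups and is the product of these subgroups, $B$ is normal, and $A\cap B=N$. Construction of $K$ and $\phi$. Choose coset representatives $c_x$: $T=\coprod_{x\in T/R}c_xR$ with $c_1=1$. Put $x_i=t_it_{i+1}\cdots t_qR\in T/R$ and define $r_i\in R$ by $c_{x_i}r_i=t_it_{i+1}\cdots t_q$; then the relation $w=1$ can be written in the form $t\prod_{i=1}^q g_i^{c_{x_i}r_i}=1$. Let $X_1=\{x_1,\dots,x_q\}\subseteq T/R$. For each $x\in T/R$ let $G^{(c_x)}$ be an isomorphic copy of $G$, with isomorphism $g\mapsto g^{(c_x)}$, and let $\bar R=\langle\bar t\rangle_\infty*\bar S$ be an isomorphic copy of $R=\langle t\rangle_\infty*S$, with isomorphism $r\mapsto\bar r$. Let $L_1=\bar R*\bigl(\mathop{*}_{y\in X_1}G^{(c_y)}\bigr)$, and let $N_1$ be the normal closure in $L_1$ of the element $\bar t\prod_{i=1}^q\bigl(g_i^{(c_{x_i})}\bigr)^{\bar r_i}$. Let $L=\bar R*\bigl(\mathop{*}_{y\in T/R}G^{(c_y)}\bigr)\supseteq L_1$. The group $T$ acts on $L$ on the right, $\phi:T\to\mathrm{Aut}\,L$, by $(\bar r)^{x^\phi}=\overline{r^x}$ and $\bigl(g^{(c_y)}\bigr)^{x^\phi}=\bigl(g^{(c_{yx})}\bigr)^{\bar a}$ for $x\in T$, $y\in T/R$, $r\in R$, $g\in G$, where $a\in R$ is uniquely determined by $c_yx=c_{yx}a$. For $x\in T/R$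 put $L_x=L_1^{\chi^\phi}$ and $N_x=N_1^{\chi^\phi}\trianglelefteq L_x$, where $\chi\in T$ is any representative of $x$. Let $K=L/\langle\langle\bigcup_{y\in T/R}N_y\rangle\rangle$. The action $\phi$ descends to an action of $T$ on $K$, denoted by the same letter $\phi:T\to\mathrm{Aut}\,K$; this action is consistent with the isomorphism $T\supseteq R\cong\bar R\subseteq K$, $r\mapsto\bar r$. $G^{(1)}=G^{(c_1)}$ is regarded as a subgroup of $K\subseteq P$. *)

theory Defs
  imports "HOL-Algebra.Generated_Groups"
begin

section \<open>Auxiliary notions for groups\<close>

definition list_prod :: "('a, 'm) monoid_scheme \<Rightarrow> 'a list \<Rightarrow> 'a" where
  "list_prod G xs = foldr (\<otimes>\<^bsub>G\<^esub>) xs \<one>\<^bsub>G\<^esub>"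

definition conj_by :: "('a, 'm) monoid_scheme \<Rightarrow> 'a \<Rightarrow> 'a \<Rightarrow> 'a" where
  "conj_by G x y = inv\<^bsub>G\<^esub> y \<otimes>\<^bsub>G\<^esub> x \<otimes>\<^bsub>G\<^esub> y"

definition normal_closure :: "('a, 'm) monoid_scheme \<Rightarrow> 'a set \<Rightarrow> 'a set" where
  "normal_closure G X = generate G {conj_by G x y | x y. x \<in> X \<and> y \<in> carrier G}"

definition torsion_free :: "('a, 'm) monoid_scheme \<Rightarrow> bool" where
  "torsion_free G \<longleftrightarrow> (\<forall>x\<in>carrier G. \<forall>n::nat. n > 0 \<longrightarrow> x [^]\<^bsub>G\<^esub> n = \<one>\<^bsub>G\<^esub> \<longrightarrow> x = \<one>\<^bsub>G\<^esub>)"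

definition uniquely_decomposed ::
  "('a, 'm) monoid_scheme \<Rightarrow> 'a set \<Rightarrow> 'a set \<Rightarrow> 'a \<Rightarrow> 'a \<Rightarrow> bool" where
  "uniquely_decomposed H X Y x y \<longleftrightarrow>
     (\<forall>x'\<in>X. \<forall>y'\<in>Y. x' \<otimes>\<^bsub>H\<^esub> y' = x \<otimes>\<^bsub>H\<^esub> y \<longrightarrow> x' = x \<and> y' = y)"

definition strong_UP :: "('a, 'm) monoid_scheme \<Rightarrow> bool" where
  "strong_UP H \<longleftrightarrow>
     (\<forall>X Y. X \<subseteq> carrier H \<and> Y \<subseteq> carrier H \<and> finite X \<and> finite Y \<and> X \<noteq> {} \<and> card Y \<ge> 2 \<longrightarrow>
        (\<exists>x1\<in>X. \<exists>x2\<in>X. \<exists>y1\<in>Y. \<exists>y2\<in>Y.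
           uniquely_decomposed H X Y x1 y1 \<and> uniquely_decomposed H X Y x2 y2 \<and> y1 \<noteq> y2))"


section \<open>Monoid presentations\<close>

inductive word_cong :: "'a set \<Rightarrow> ('a list \<times> 'a list) set \<Rightarrow> 'a list \<Rightarrow> 'a list \<Rightarrow> bool"
  for A :: "'a set" and \<rho> :: "('a list \<times> 'a list) set" where
  refl: "w \<in> lists A \<Longrightarrow> word_cong A \<rho> w w"
| sym: "word_cong A \<rho> u v \<Longrightarrow> word_cong A \<rho> v u"
| trans: "word_cong A \<rho> u v \<Longrightarrow> word_cong A \<rho> v w \<Longrightarrow> word_cong A \<rho> u w"
| rule: "(l, r) \<in> \<rho> \<Longrightarrow> l \<in> lists A \<Longrightarrow> r \<in> lists A \<Longrightarrow> u \<in> lists A \<Longrightarrow> v \<in> lists A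
    \<Longrightarrow> word_cong A \<rho> (u @ l @ v) (u @ r @ v)"

definition word_class :: "'a set \<Rightarrow> ('a list \<times> 'a list) set \<Rightarrow> 'a list \<Rightarrow> 'a list set" where
  "word_class A \<rho> w = {v. word_cong A \<rho> w v}"

definition presented :: "'a set \<Rightarrow> ('a list \<times> 'a list) set \<Rightarrow> 'a list set monoid" where
  "presented A \<rho> =
     \<lparr>carrier = word_class A \<rho> ` lists A,
      mult = (\<lambda>C D. \<Union>u\<in>C. \<Union>v\<in>D. word_class A \<rho> (u @ v)),
      one = word_class A \<rho> []\<rparr>"

text \<open>The homomorphism from a presented monoid to \<open>H\<close> that extends a map \<open>f\<close> of the letters;
  meaningful when \<open>f\<close> respects the relations (lemma \<open>lift_hom\<close>).\<close>

definition lift :: "('b, 'm) monoid_scheme \<Rightarrow> ('a \<Rightarrow> 'b) \<Rightarrow> 'a list set \<Rightarrow> 'b" where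
  "lift H f C = list_prod H (map f (SOME w. w \<in> C))"

lemma word_cong_lists: "word_cong A \<rho> u v \<Longrightarrow> u \<in> lists A \<and> v \<in> lists A"
  by (induction rule: word_cong.induct) auto

lemma word_cong_ctx:
  assumes "word_cong A \<rho> u v" "p \<in> lists A" "q \<in> lists A"
  shows "word_cong A \<rho> (p @ u @ q) (p @ v @ q)"
  using assms
proof (induction rule: word_cong.induct)
  case (refl w)
  then show ?case by (intro word_cong.refl) auto
next
  case (sym u v)
  then show ?case by (blast intro: word_cong.sym)
next
  case (trans u v w)
  then show ?case by (metis word_cong.trans)
next
  case (rule l r u v)
  have "word_cong A \<rho> ((p @ u) @ l @ (v @ q)) ((p @ u) @ r @ (v @ q))"
    by (rule word_cong.rule) (use rule in auto)
  then show ?case by simp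
qed

lemma word_cong_append:
  assumes "word_cong A \<rho> u u'" "word_cong A \<rho> v v'"
  shows "word_cong A \<rho> (u @ v) (u' @ v')"
proof -
  have "word_cong A \<rho> (u @ v) (u' @ v)"
    using word_cong_ctx[OF assms(1), of "[]" v] word_cong_lists[OF assms(2)] by simp
  moreover have "word_cong A \<rho> (u' @ v) (u' @ v')"
    using word_cong_ctx[OF assms(2), of u' "[]"] word_cong_lists[OF assms(1)] by simp
  ultimately show ?thesis by (rule word_cong.trans)
qed

lemma word_class_eqI: "word_cong A \<rho> u v \<Longrightarrow> word_class A \<rho> u = word_class A \<rho> v"
  unfolding word_class_def by (rule Collect_cong) (metis word_cong.sym word_cong.trans)

lemma word_class_self: "w \<in> lists A \<Longrightarrow> w \<in> word_class A \<rho> w"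
  unfolding word_class_def by (auto intro: word_cong.refl)

lemma presented_mult:
  assumes "u \<in> lists A" "v \<in> lists A"
  shows "word_class A \<rho> u \<otimes>\<^bsub>presented A \<rho>\<^esub> word_class A \<rho> v = word_class A \<rho> (u @ v)"
proof -
  let ?C = "word_class A \<rho> u" and ?D = "word_class A \<rho> v"
  have eq: "word_class A \<rho> (u' @ v') = word_class A \<rho> (u @ v)" if "u' \<in> ?C" "v' \<in> ?D" for u' v'
  proof (rule word_class_eqI, rule word_cong.sym, rule word_cong_append)
    show "word_cong A \<rho> u u'" using that(1) by (simp add: word_class_def)
    show "word_cong A \<rho> v v'" using that(2) by (simp add: word_class_def)
  qed
  have "?C \<otimes>\<^bsub>presented A \<rho>\<^esub> ?D = (\<Union>u'\<in>?C. \<Union>v'\<in>?D. word_class A \<rho> (u' @ v'))"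
    by (simp add: presented_def)
  also have "\<dots> = (\<Union>u'\<in>?C. \<Union>v'\<in>?D. word_class A \<rho> (u @ v))"
    by (intro SUP_cong HOL.refl eq)
  also have "\<dots> = word_class A \<rho> (u @ v)"
    using word_class_self[OF assms(1), of \<rho>] word_class_self[OF assms(2), of \<rho>] by blast
  finally show ?thesis .
qed

lemma presented_one: "\<one>\<^bsub>presented A \<rho>\<^esub> = word_class A \<rho> []"
  by (simp add: presented_def)

lemma presented_carrier: "carrier (presented A \<rho>) = word_class A \<rho> ` lists A"
  by (simp add: presented_def)

lemma group_presented:
  assumes inv: "\<And>a. a \<in> A \<Longrightarrow> \<exists>b\<in>A. word_cong A \<rho> [b, a] []"
  shows "group (presented A \<rho>)"
proof (rule groupI)
  fix x y assume "x \<in> carrier (presented A \<rho>)" "y \<in> carrier (presented A \<rho>)"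
  then show "x \<otimes>\<^bsub>presented A \<rho>\<^esub> y \<in> carrier (presented A \<rho>)"
    unfolding presented_carrier using presented_mult append_in_lists_conv by (smt (verit) imageE imageI)
next
  show "\<one>\<^bsub>presented A \<rho>\<^esub> \<in> carrier (presented A \<rho>)"
    by (auto simp: presented_carrier presented_one)
next
  fix x y z assume "x \<in> carrier (presented A \<rho>)" "y \<in> carrier (presented A \<rho>)"
    "z \<in> carrier (presented A \<rho>)"
  then obtain u v w where "u \<in> lists A" "v \<in> lists A" "w \<in> lists A"
    "x = word_class A \<rho> u" "y = word_class A \<rho> v" "z = word_class A \<rho> w"
    by (auto simp: presented_carrier)
  moreover from this have "u @ v \<in> lists A" "v @ w \<in> lists A" by auto
  ultimately show "x \<otimes>\<^bsub>presented A \<rho>\<^esub> y \<otimes>\<^bsub>presented A \<rho>\<^esub> z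
      = x \<otimes>\<^bsub>presented A \<rho>\<^esub> (y \<otimes>\<^bsub>presented A \<rho>\<^esub> z)"
    by (simp only: presented_mult append_assoc)
next
  fix x assume "x \<in> carrier (presented A \<rho>)"
  then show "\<one>\<^bsub>presented A \<rho>\<^esub> \<otimes>\<^bsub>presented A \<rho>\<^esub> x = x"
    unfolding presented_carrier presented_one
    using presented_mult[of "[]"] by fastforce
next
  fix x assume "x \<in> carrier (presented A \<rho>)"
  then obtain w where w: "w \<in> lists A" "x = word_class A \<rho> w"
    by (auto simp: presented_carrier)
  have "\<exists>v\<in>lists A. word_cong A \<rho> (v @ w) []"
    using w(1)
  proof (induction w)
    case Nil
    then show ?case by (auto intro!: bexI[of _ "[]"] word_cong.refl)
  next
    case (Cons a w)
    then obtain v where v: "v \<in> lists A" "word_cong A \<rho> (v @ w) []" by auto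
    from Cons have "a \<in> A" by simp
    then obtain b where b: "b \<in> A" "word_cong A \<rho> [b, a] []" using inv by blast
    have "word_cong A \<rho> (v @ [b, a] @ w) (v @ [] @ w)"
      using Cons v b by (intro word_cong_ctx) auto
    then have "word_cong A \<rho> (v @ [b, a] @ w) []"
      using v(2) word_cong.trans by fastforce
    then have "word_cong A \<rho> ((v @ [b]) @ (a # w)) []" by simp
    with v b show ?case by (intro bexI[of _ "v @ [b]"]) auto
  qed
  then obtain v where v: "v \<in> lists A" "word_cong A \<rho> (v @ w) []" by auto
  then show "\<exists>y\<in>carrier (presented A \<rho>). y \<otimes>\<^bsub>presented A \<rho>\<^esub> x = \<one>\<^bsub>presented A \<rho>\<^esub>"
    unfolding presented_carrier presented_one
    using w presented_mult[of v A w] word_class_eqI by (metis imageI)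
qed

lemma (in monoid) list_prod_closed:
  "set xs \<subseteq> carrier G \<Longrightarrow> list_prod G xs \<in> carrier G"
  by (induction xs) (auto simp: list_prod_def)

lemma (in monoid) list_prod_append:
  "set xs \<subseteq> carrier G \<Longrightarrow> set ys \<subseteq> carrier G \<Longrightarrow>
    list_prod G (xs @ ys) = list_prod G xs \<otimes> list_prod G ys"
proof (induction xs)
  case Nil
  then show ?case using list_prod_closed[of ys] by (simp add: list_prod_def)
next
  case (Cons a xs)
  then show ?case using list_prod_closed[of ys] list_prod_closed[of xs]
    by (simp add: list_prod_def m_assoc)
qed

lemma lift_word_class:
  assumes "monoid H" "\<And>a. a \<in> A \<Longrightarrow> f a \<in> carrier H"
    and rel: "\<And>l r. (l, r) \<in> \<rho> \<Longrightarrow> l \<in> lists A \<Longrightarrow> r \<in> lists A \<Longrightarrow>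
           list_prod H (map f l) = list_prod H (map f r)"
    and "w \<in> lists A"
  shows "lift H f (word_class A \<rho> w) = list_prod H (map f w)"
proof -
  interpret H: monoid H by fact
  have f: "set (map f u) \<subseteq> carrier H" if "u \<in> lists A" for u
    using that assms(2) by auto
  have "list_prod H (map f u) = list_prod H (map f v)" if "word_cong A \<rho> u v" for u v
    using that
  proof (induction rule: word_cong.induct)
    case (rule l r u v)
    then have "set (map f u) \<subseteq> carrier H" "set (map f v) \<subseteq> carrier H"
      "set (map f l) \<subseteq> carrier H" "set (map f r) \<subseteq> carrier H"
      using f by blast+
    moreover from this have "set (map f (l @ v)) \<subseteq> carrier H" "set (map f (r @ v)) \<subseteq> carrier H"
      by auto
    ultimately show ?case using rel[OF rule(1,2,3)] by (simp only: map_append H.list_prod_append)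
  qed auto
  moreover have "(SOME v. v \<in> word_class A \<rho> w) \<in> word_class A \<rho> w"
    using word_class_self[OF assms(4)] by (rule someI)
  ultimately show ?thesis unfolding lift_def word_class_def by (metis mem_Collect_eq)
qed

lemma lift_hom:
  assumes "monoid H" "\<And>a. a \<in> A \<Longrightarrow> f a \<in> carrier H"
    and "\<And>l r. (l, r) \<in> \<rho> \<Longrightarrow> l \<in> lists A \<Longrightarrow> r \<in> lists A \<Longrightarrow>
           list_prod H (map f l) = list_prod H (map f r)"
  shows "lift H f \<in> hom (presented A \<rho>) H"
proof -
  interpret H: monoid H by fact
  have f: "set (map f u) \<subseteq> carrier H" if "u \<in> lists A" for u
    using that assms(2) by auto
  note lw = lift_word_class[of H A f \<rho>, OF assms]
  show ?thesis
  proof (rule homI)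
    fix x assume "x \<in> carrier (presented A \<rho>)"
    then obtain u where "u \<in> lists A" "x = word_class A \<rho> u"
      unfolding presented_carrier by blast
    then show "lift H f x \<in> carrier H"
      using lw[of u] H.list_prod_closed[OF f[of u]] by (simp only:)
  next
    fix x y assume "x \<in> carrier (presented A \<rho>)" "y \<in> carrier (presented A \<rho>)"
    then obtain u v where uv: "u \<in> lists A" "v \<in> lists A"
      "x = word_class A \<rho> u" "y = word_class A \<rho> v"
      by (auto simp: presented_carrier)
    then have "u @ v \<in> lists A" by auto
    with uv show "lift H f (x \<otimes>\<^bsub>presented A \<rho>\<^esub> y) = lift H f x \<otimes>\<^bsub>H\<^esub> lift H f y"
      using H.list_prod_append[OF f[OF uv(1)] f[OF uv(2)]] lw[of u] lw[of v] lw[of "u @ v"]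
      by (simp only: presented_mult map_append)
  qed
qed


section \<open>Free products\<close>

text \<open>The multiplication table of the factor \<open>H\<close>, whose elements \<open>h\<close> enter words as letters \<open>e h\<close>.\<close>

definition factor_rules :: "('a \<Rightarrow> 'l) \<Rightarrow> ('a, 'm) monoid_scheme \<Rightarrow> ('l list \<times> 'l list) set" where
  "factor_rules e H =
     insert ([e \<one>\<^bsub>H\<^esub>], []) {([e a, e b], [e (a \<otimes>\<^bsub>H\<^esub> b)]) | a b. a \<in> carrier H \<and> b \<in> carrier H}"

definition free_product ::
  "('a, 'm) monoid_scheme \<Rightarrow> ('b, 'n) monoid_scheme \<Rightarrow> ('a + 'b) list set monoid" where
  "free_product A B = presented (carrier A <+> carrier B) (factor_rules Inl A \<union> factor_rules Inr B)"

definition free_inl ::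
  "('a, 'm) monoid_scheme \<Rightarrow> ('b, 'n) monoid_scheme \<Rightarrow> 'a \<Rightarrow> ('a + 'b) list set" where
  "free_inl A B a =
     word_class (carrier A <+> carrier B) (factor_rules Inl A \<union> factor_rules Inr B) [Inl a]"

definition free_inr ::
  "('a, 'm) monoid_scheme \<Rightarrow> ('b, 'n) monoid_scheme \<Rightarrow> 'b \<Rightarrow> ('a + 'b) list set" where
  "free_inr A B b =
     word_class (carrier A <+> carrier B) (factor_rules Inl A \<union> factor_rules Inr B) [Inr b]"

definition free_product_family :: "'i set \<Rightarrow> ('i \<Rightarrow> ('a, 'm) monoid_scheme) \<Rightarrow> ('i \<times> 'a) list set monoid" where
  "free_product_family I F =
     presented (SIGMA i:I. carrier (F i)) (\<Union>i\<in>I. factor_rules (Pair i) (F i))"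

definition free_in :: "'i set \<Rightarrow> ('i \<Rightarrow> ('a, 'm) monoid_scheme) \<Rightarrow> 'i \<Rightarrow> 'a \<Rightarrow> ('i \<times> 'a) list set" where
  "free_in I F i a =
     word_class (SIGMA i:I. carrier (F i)) (\<Union>i\<in>I. factor_rules (Pair i) (F i)) [(i, a)]"

lemma factor_rules_inverse:
  assumes "group H" "a \<in> carrier H" "factor_rules e H \<subseteq> \<rho>" "e ` carrier H \<subseteq> A"
  shows "word_cong A \<rho> [e (inv\<^bsub>H\<^esub> a), e a] []"
proof -
  interpret H: group H by fact
  have in_A: "e h \<in> A" if "h \<in> carrier H" for h
    using that assms(4) by auto
  have "([e (inv\<^bsub>H\<^esub> a), e a], [e \<one>\<^bsub>H\<^esub>]) \<in> \<rho>"
    using assms(2,3) H.l_inv[OF assms(2)] H.inv_closed[OF assms(2)]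
    unfolding factor_rules_def by fastforce
  from word_cong.rule[OF this, of A "[]" "[]"]
  have "word_cong A \<rho> [e (inv\<^bsub>H\<^esub> a), e a] [e \<one>\<^bsub>H\<^esub>]"
    using in_A assms(2) by simp
  moreover have "([e \<one>\<^bsub>H\<^esub>], []) \<in> \<rho>"
    using assms(3) by (auto simp: factor_rules_def)
  from word_cong.rule[OF this, of A "[]" "[]"]
  have "word_cong A \<rho> [e \<one>\<^bsub>H\<^esub>] []"
    using in_A by simp
  ultimately show ?thesis by (rule word_cong.trans)
qed

lemma group_free_product:
  assumes "group A" "group B"
  shows "group (free_product A B)"
  unfolding free_product_def
proof (rule group_presented)
  fix x assume "x \<in> carrier A <+> carrier B"
  then consider a where "a \<in> carrier A" "x = Inl a" | b where "b \<in> carrier B" "x = Inr b"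
    by blast
  then show "\<exists>y\<in>carrier A <+> carrier B. word_cong (carrier A <+> carrier B)
      (factor_rules Inl A \<union> factor_rules Inr B) [y, x] []"
  proof cases
    case 1
    then show ?thesis
      using assms by (intro bexI[of _ "Inl (inv\<^bsub>A\<^esub> a)"]) (auto intro!: factor_rules_inverse)
  next
    case 2
    then show ?thesis
      using assms by (intro bexI[of _ "Inr (inv\<^bsub>B\<^esub> b)"]) (auto intro!: factor_rules_inverse)
  qed
qed

lemma group_free_product_family:
  assumes "\<And>i. i \<in> I \<Longrightarrow> group (F i)"
  shows "group (free_product_family I F)"
  unfolding free_product_family_def
proof (rule group_presented)
  fix x assume "x \<in> (SIGMA i:I. carrier (F i))"
  then obtain i a where x: "i \<in> I" "a \<in> carrier (F i)" "x = (i, a)" by auto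
  then have "word_cong (SIGMA i:I. carrier (F i)) (\<Union>i\<in>I. factor_rules (Pair i) (F i))
      [(i, inv\<^bsub>F i\<^esub> a), x] []"
    using assms by (auto intro!: factor_rules_inverse)
  then show "\<exists>y\<in>SIGMA i:I. carrier (F i). word_cong (SIGMA i:I. carrier (F i))
      (\<Union>i\<in>I. factor_rules (Pair i) (F i)) [y, x] []"
    using x assms by (intro bexI[of _ "(i, inv\<^bsub>F i\<^esub> a)"]) auto
qed

lemma factor_rules_respected:
  assumes "group H" "group K" "f \<circ> e \<in> hom H K" "(l, r) \<in> factor_rules e H"
  shows "list_prod K (map f l) = list_prod K (map f r)"
proof -
  interpret group_hom H K "f \<circ> e" using assms by (simp add: group_hom_def group_hom_axioms_def)
  show ?thesis
    using assms(4) hom_one hom_mult hom_closed by (auto simp: factor_rules_def list_prod_def)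
qed

lemma lift_free_product:
  assumes "group A" "group B" "group H" "f \<in> hom A H" "g \<in> hom B H"
  shows "lift H (case_sum f g) \<in> hom (free_product A B) H"
    and "a \<in> carrier A \<Longrightarrow> lift H (case_sum f g) (free_inl A B a) = f a"
    and "b \<in> carrier B \<Longrightarrow> lift H (case_sum f g) (free_inr A B b) = g b"
proof -
  interpret H: group H by fact
  let ?A = "carrier A <+> carrier B" and ?\<rho> = "factor_rules Inl A \<union> factor_rules Inr B"
  have fg: "case_sum f g \<circ> Inl \<in> hom A H" "case_sum f g \<circ> Inr \<in> hom B H"
    using assms by (simp_all add: comp_def)
  have 1: "case_sum f g x \<in> carrier H" if "x \<in> ?A" for x
    using that assms(4,5) by (auto simp: hom_def)
  have 2: "list_prod H (map (case_sum f g) l) = list_prod H (map (case_sum f g) r)"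
    if "(l, r) \<in> ?\<rho>" for l r
    using that factor_rules_respected[OF assms(1,3) fg(1)] factor_rules_respected[OF assms(2,3) fg(2)]
    by blast
  note H = H.monoid_axioms
  show "lift H (case_sum f g) \<in> hom (free_product A B) H"
    unfolding free_product_def by (rule lift_hom[OF H 1 2])
  show "lift H (case_sum f g) (free_inl A B a) = f a" if "a \<in> carrier A"
  proof -
    have "lift H (case_sum f g) (word_class ?A ?\<rho> [Inl a]) = list_prod H (map (case_sum f g) [Inl a])"
      by (rule lift_word_class[OF H 1 2]) (use that in auto)
    then show ?thesis
      using that 1[of "Inl a"] by (simp add: list_prod_def free_inl_def InlI)
  qed
  show "lift H (case_sum f g) (free_inr A B b) = g b" if "b \<in> carrier B"
  proof -
    have "lift H (case_sum f g) (word_class ?A ?\<rho> [Inr b]) = list_prod H (map (case_sum f g) [Inr b])"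
      by (rule lift_word_class[OF H 1 2]) (use that in auto)
    then show ?thesis
      using that 1[of "Inr b"] by (simp add: list_prod_def free_inr_def InrI)
  qed
qed

lemma lift_free_product_family:
  assumes "\<And>i. i \<in> I \<Longrightarrow> group (F i)" "group H" "\<And>i. i \<in> I \<Longrightarrow> f i \<in> hom (F i) H"
  shows "lift H (case_prod f) \<in> hom (free_product_family I F) H"
    and "i \<in> I \<Longrightarrow> a \<in> carrier (F i) \<Longrightarrow> lift H (case_prod f) (free_in I F i a) = f i a"
proof -
  interpret H: group H by fact
  let ?A = "SIGMA i:I. carrier (F i)" and ?\<rho> = "\<Union>i\<in>I. factor_rules (Pair i) (F i)"
  have 1: "case_prod f x \<in> carrier H" if "x \<in> ?A" for x
    using that assms(3) by (auto simp: hom_def)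
  have 2: "list_prod H (map (case_prod f) l) = list_prod H (map (case_prod f) r)"
    if "(l, r) \<in> ?\<rho>" for l r
  proof -
    from that obtain i where i: "i \<in> I" "(l, r) \<in> factor_rules (Pair i) (F i)" by blast
    have "case_prod f \<circ> Pair i \<in> hom (F i) H"
      using assms(3)[OF i(1)] by (simp add: comp_def)
    then show ?thesis
      using factor_rules_respected[OF assms(1)[OF i(1)] assms(2) _ i(2)] by blast
  qed
  note H = H.monoid_axioms
  show "lift H (case_prod f) \<in> hom (free_product_family I F) H"
    unfolding free_product_family_def by (rule lift_hom[OF H 1 2])
  show "lift H (case_prod f) (free_in I F i a) = f i a" if "i \<in> I" "a \<in> carrier (F i)"
  proof -
    have "lift H (case_prod f) (word_class ?A ?\<rho> [(i, a)]) = list_prod H (map (case_prod f) [(i, a)])"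
      by (rule lift_word_class[OF H 1 2]) (use that in auto)
    then show ?thesis
      using that 1[of "(i, a)"] by (auto simp: list_prod_def free_in_def)
  qed
qed

text \<open>\<open>R\<close> is the (internal) free product of its subgroups \<open>A\<close> and \<open>B\<close>.\<close>

definition internal_free_product ::
  "('a, 'm) monoid_scheme \<Rightarrow> 'a set \<Rightarrow> 'a set \<Rightarrow> 'a set \<Rightarrow> bool" where
  "internal_free_product G R A B \<longleftrightarrow>
     subgroup R G \<and> subgroup A G \<and> subgroup B G \<and>
     lift G (case_sum id id) \<in> iso (free_product (G\<lparr>carrier := A\<rparr>) (G\<lparr>carrier := B\<rparr>)) (G\<lparr>carrier := R\<rparr>)"


section \<open>Amalgamated semidirect products\<close>

text \<open>Automorphisms act on the right: \<open>\<phi> a b\<close> is the image of \<open>b\<close> under the automorphism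
  \<open>\<phi> a\<close>, and \<open>\<phi> (a \<otimes> a')\<close> is \<open>\<phi> a\<close> followed by \<open>\<phi> a'\<close>. The pair \<open>(a, b)\<close> is the formal
  product \<open>a b\<close>.\<close>

definition semidirect ::
  "('a, 'm) monoid_scheme \<Rightarrow> ('b, 'n) monoid_scheme \<Rightarrow> ('a \<Rightarrow> 'b \<Rightarrow> 'b) \<Rightarrow> ('a \<times> 'b) monoid" where
  "semidirect A B \<phi> =
     \<lparr>carrier = carrier A \<times> carrier B,
      mult = (\<lambda>(a, b) (a', b'). (a \<otimes>\<^bsub>A\<^esub> a', \<phi> a' b \<otimes>\<^bsub>B\<^esub> b')),
      one = (\<one>\<^bsub>A\<^esub>, \<one>\<^bsub>B\<^esub>)\<rparr>"

definition amalgam_kernel ::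
  "('b, 'n) monoid_scheme \<Rightarrow> 'a set \<Rightarrow> ('a \<Rightarrow> 'b) \<Rightarrow> ('a \<times> 'b) set" where
  "amalgam_kernel B N \<psi> = {(n, inv\<^bsub>B\<^esub> (\<psi> n)) | n. n \<in> N}"

definition amalgamated_semidirect ::
  "('a, 'm) monoid_scheme \<Rightarrow> ('b, 'n) monoid_scheme \<Rightarrow> ('a \<Rightarrow> 'b \<Rightarrow> 'b) \<Rightarrow> 'a set \<Rightarrow> ('a \<Rightarrow> 'b)
    \<Rightarrow> ('a \<times> 'b) set monoid" where
  "amalgamated_semidirect A B \<phi> N \<psi> = semidirect A B \<phi> Mod amalgam_kernel B N \<psi>"

definition amalgam_inl ::
  "('a, 'm) monoid_scheme \<Rightarrow> ('b, 'n) monoid_scheme \<Rightarrow> ('a \<Rightarrow> 'b \<Rightarrow> 'b) \<Rightarrow> 'a set \<Rightarrow> ('a \<Rightarrow> 'b)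
    \<Rightarrow> 'a \<Rightarrow> ('a \<times> 'b) set" where
  "amalgam_inl A B \<phi> N \<psi> a = amalgam_kernel B N \<psi> #>\<^bsub>semidirect A B \<phi>\<^esub> (a, \<one>\<^bsub>B\<^esub>)"

definition amalgam_inr ::
  "('a, 'm) monoid_scheme \<Rightarrow> ('b, 'n) monoid_scheme \<Rightarrow> ('a \<Rightarrow> 'b \<Rightarrow> 'b) \<Rightarrow> 'a set \<Rightarrow> ('a \<Rightarrow> 'b)
    \<Rightarrow> 'b \<Rightarrow> ('a \<times> 'b) set" where
  "amalgam_inr A B \<phi> N \<psi> b = amalgam_kernel B N \<psi> #>\<^bsub>semidirect A B \<phi>\<^esub> (\<one>\<^bsub>A\<^esub>, b)"


section \<open>Words over \<open>G * T\<close> and one-relator relative presentations\<close>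

text \<open>The word \<open>g\<^sub>1 t\<^sub>1 \<dots> g\<^sub>q t\<^sub>q\<close> is given by the list \<open>[(g\<^sub>1, t\<^sub>1), \<dots>, (g\<^sub>q, t\<^sub>q)]\<close>.\<close>

definition cyclically_reduced ::
  "('g, 'm) monoid_scheme \<Rightarrow> ('t, 'n) monoid_scheme \<Rightarrow> ('g \<times> 't) list \<Rightarrow> bool" where
  "cyclically_reduced G T w \<longleftrightarrow>
     length w = 1 \<or> (\<forall>(g, t)\<in>set w. g \<noteq> \<one>\<^bsub>G\<^esub> \<and> t \<noteq> \<one>\<^bsub>T\<^esub>)"

definition T_product :: "('t, 'n) monoid_scheme \<Rightarrow> ('g \<times> 't) list \<Rightarrow> 't" where
  "T_product T w = list_prod T (map snd w)"

definition generalised_unimodular_with ::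
  "('t, 'n) monoid_scheme \<Rightarrow> ('g \<times> 't) list \<Rightarrow> 't set \<Rightarrow> 't set \<Rightarrow> bool" where
  "generalised_unimodular_with T w R S \<longleftrightarrow>
     T_product T w \<noteq> \<one>\<^bsub>T\<^esub> \<and> torsion_free T \<and>
     R \<lhd> T \<and> internal_free_product T R (generate T {T_product T w}) S \<and>
     strong_UP (T Mod R)"

definition relative_word ::
  "('g, 'm) monoid_scheme \<Rightarrow> ('t, 'n) monoid_scheme \<Rightarrow> ('g \<times> 't) list \<Rightarrow> ('g + 't) list set" where
  "relative_word G T w =
     list_prod (free_product G T)
       (map (\<lambda>(g, t). free_inl G T g \<otimes>\<^bsub>free_product G T\<^esub> free_inr G T t) w)"

definition one_relator_kernel ::
  "('g, 'm) monoid_scheme \<Rightarrow> ('t, 'n) monoid_scheme \<Rightarrow> ('g \<times> 't) list \<Rightarrow> ('g + 't) list set set" where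
  "one_relator_kernel G T w = normal_closure (free_product G T) {relative_word G T w}"

definition Ghat ::
  "('g, 'm) monoid_scheme \<Rightarrow> ('t, 'n) monoid_scheme \<Rightarrow> ('g \<times> 't) list \<Rightarrow> ('g + 't) list set set monoid" where
  "Ghat G T w = free_product G T Mod one_relator_kernel G T w"

definition Ghat_G ::
  "('g, 'm) monoid_scheme \<Rightarrow> ('t, 'n) monoid_scheme \<Rightarrow> ('g \<times> 't) list \<Rightarrow> 'g \<Rightarrow> ('g + 't) list set set" where
  "Ghat_G G T w g = one_relator_kernel G T w #>\<^bsub>free_product G T\<^esub> free_inl G T g"

definition Ghat_T ::
  "('g, 'm) monoid_scheme \<Rightarrow> ('t, 'n) monoid_scheme \<Rightarrow> ('g \<times> 't) list \<Rightarrow> 't \<Rightarrow> ('g + 't) list set set" where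
  "Ghat_T G T w t = one_relator_kernel G T w #>\<^bsub>free_product G T\<^esub> free_inr G T t"


section \<open>The group \<open>K\<close> and the action of \<open>T\<close> on it\<close>

definition transversal :: "('t, 'n) monoid_scheme \<Rightarrow> 't set \<Rightarrow> ('t set \<Rightarrow> 't) \<Rightarrow> bool" where
  "transversal T R c \<longleftrightarrow> (\<forall>y\<in>carrier (T Mod R). c y \<in> y) \<and> c R = \<one>\<^bsub>T\<^esub>"

text \<open>The copy of \<open>G\<close> attached to the coset \<open>y\<close> is the factor with index \<open>y\<close>; the group \<open>R\<close> itself
  serves as its copy.\<close>

type_synonym ('g, 't) L_elem = "('t + ('t set \<times> 'g) list set) list set"

definition L_group ::
  "('g, 'm) monoid_scheme \<Rightarrow> ('t, 'n) monoid_scheme \<Rightarrow> 't set \<Rightarrow> ('g, 't) L_elem monoid" where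
  "L_group G T R =
     free_product (T\<lparr>carrier := R\<rparr>) (free_product_family (carrier (T Mod R)) (\<lambda>_. G))"

definition L_bar ::
  "('g, 'm) monoid_scheme \<Rightarrow> ('t, 'n) monoid_scheme \<Rightarrow> 't set \<Rightarrow> 't \<Rightarrow> ('g, 't) L_elem" where
  "L_bar G T R =
     free_inl (T\<lparr>carrier := R\<rparr>) (free_product_family (carrier (T Mod R)) (\<lambda>_. G))"

definition L_copy ::
  "('g, 'm) monoid_scheme \<Rightarrow> ('t, 'n) monoid_scheme \<Rightarrow> 't set \<Rightarrow> 't set \<Rightarrow> 'g \<Rightarrow> ('g, 't) L_elem" where
  "L_copy G T R y g =
     free_inr (T\<lparr>carrier := R\<rparr>) (free_product_family (carrier (T Mod R)) (\<lambda>_. G))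
       (free_in (carrier (T Mod R)) (\<lambda>_. G) y g)"

text \<open>For a coset \<open>y\<close> of \<open>R\<close>, the coset \<open>y x\<close> is \<open>y #> x\<close>, and the element \<open>a\<close> of \<open>R\<close> with
  \<open>c\<^sub>y x = c\<^sub>y\<^sub>x a\<close> is \<open>inv c\<^sub>y\<^sub>x \<otimes> c\<^sub>y \<otimes> x\<close>.\<close>

definition L_action ::
  "('g, 'm) monoid_scheme \<Rightarrow> ('t, 'n) monoid_scheme \<Rightarrow> 't set \<Rightarrow> ('t set \<Rightarrow> 't) \<Rightarrow> 't
    \<Rightarrow> ('g, 't) L_elem \<Rightarrow> ('g, 't) L_elem" where
  "L_action G T R c x = restrict
     (lift (L_group G T R) (case_sum
        (\<lambda>r. L_bar G T R (conj_by T r x))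
        (lift (L_group G T R) (\<lambda>(y, g).
           conj_by (L_group G T R) (L_copy G T R (y #>\<^bsub>T\<^esub> x) g)
             (L_bar G T R (inv\<^bsub>T\<^esub> (c (y #>\<^bsub>T\<^esub> x)) \<otimes>\<^bsub>T\<^esub> c y \<otimes>\<^bsub>T\<^esub> x))))))
     (carrier (L_group G T R))"

text \<open>With indices starting from \<open>0\<close>: the product \<open>t\<^sub>i \<dots> t\<^sub>q\<close>, its coset \<open>x\<^sub>i\<close> and the element
  \<open>r\<^sub>i\<close> of \<open>R\<close> with \<open>c\<^bsub>x\<^sub>i\<^esub> r\<^sub>i = t\<^sub>i \<dots> t\<^sub>q\<close>.\<close>

definition tail_product :: "('t, 'n) monoid_scheme \<Rightarrow> ('g \<times> 't) list \<Rightarrow> nat \<Rightarrow> 't" where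
  "tail_product T w i = T_product T (drop i w)"

definition tail_coset :: "('t, 'n) monoid_scheme \<Rightarrow> 't set \<Rightarrow> ('g \<times> 't) list \<Rightarrow> nat \<Rightarrow> 't set" where
  "tail_coset T R w i = R #>\<^bsub>T\<^esub> tail_product T w i"

definition tail_rem ::
  "('t, 'n) monoid_scheme \<Rightarrow> 't set \<Rightarrow> ('t set \<Rightarrow> 't) \<Rightarrow> ('g \<times> 't) list \<Rightarrow> nat \<Rightarrow> 't" where
  "tail_rem T R c w i = inv\<^bsub>T\<^esub> (c (tail_coset T R w i)) \<otimes>\<^bsub>T\<^esub> tail_product T w i"

definition L_relator ::
  "('g, 'm) monoid_scheme \<Rightarrow> ('t, 'n) monoid_scheme \<Rightarrow> 't set \<Rightarrow> ('t set \<Rightarrow> 't) \<Rightarrow> ('g \<times> 't) list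
    \<Rightarrow> ('g, 't) L_elem" where
  "L_relator G T R c w =
     L_bar G T R (T_product T w) \<otimes>\<^bsub>L_group G T R\<^esub>
     list_prod (L_group G T R)
       (map (\<lambda>i. conj_by (L_group G T R)
                   (L_copy G T R (tail_coset T R w i) (fst (w ! i)))
                   (L_bar G T R (tail_rem T R c w i)))
         [0..<length w])"

text \<open>\<open>L\<^sub>1\<close> is the free product of the factors \<open>R\<close> and \<open>G\<^bsup>(y)\<^esup>\<close> with \<open>y \<in> X\<^sub>1\<close>,
  regarded as a subgroup of \<open>L\<close>.\<close>

definition L1_sub ::
  "('g, 'm) monoid_scheme \<Rightarrow> ('t, 'n) monoid_scheme \<Rightarrow> 't set \<Rightarrow> ('g \<times> 't) list \<Rightarrow> ('g, 't) L_elem set" where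
  "L1_sub G T R w = generate (L_group G T R)
     (L_bar G T R ` R \<union> (\<Union>i<length w. L_copy G T R (tail_coset T R w i) ` carrier G))"

definition N1_sub ::
  "('g, 'm) monoid_scheme \<Rightarrow> ('t, 'n) monoid_scheme \<Rightarrow> 't set \<Rightarrow> ('t set \<Rightarrow> 't) \<Rightarrow> ('g \<times> 't) list
    \<Rightarrow> ('g, 't) L_elem set" where
  "N1_sub G T R c w =
     normal_closure (L_group G T R\<lparr>carrier := L1_sub G T R w\<rparr>) {L_relator G T R c w}"

text \<open>The translate of \<open>N\<^sub>1\<close> does not depend on the representative of the coset \<open>y\<close>, because an
  element \<open>r\<close> of \<open>R\<close> acts on \<open>L\<close> as conjugation by its copy in \<open>L\<^sub>1\<close>
  (lemma \<open>L_action_conj\<close>); \<open>c y\<close> is taken.\<close>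

definition N_sub ::
  "('g, 'm) monoid_scheme \<Rightarrow> ('t, 'n) monoid_scheme \<Rightarrow> 't set \<Rightarrow> ('t set \<Rightarrow> 't) \<Rightarrow> ('g \<times> 't) list
    \<Rightarrow> 't set \<Rightarrow> ('g, 't) L_elem set" where
  "N_sub G T R c w y = L_action G T R c (c y) ` N1_sub G T R c w"

definition K_kernel ::
  "('g, 'm) monoid_scheme \<Rightarrow> ('t, 'n) monoid_scheme \<Rightarrow> 't set \<Rightarrow> ('t set \<Rightarrow> 't) \<Rightarrow> ('g \<times> 't) list
    \<Rightarrow> ('g, 't) L_elem set" where
  "K_kernel G T R c w =
     normal_closure (L_group G T R) (\<Union>y\<in>carrier (T Mod R). N_sub G T R c w y)"

definition K_group ::
  "('g, 'm) monoid_scheme \<Rightarrow> ('t, 'n) monoid_scheme \<Rightarrow> 't set \<Rightarrow> ('t set \<Rightarrow> 't) \<Rightarrow> ('g \<times> 't) list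
    \<Rightarrow> ('g, 't) L_elem set monoid" where
  "K_group G T R c w = L_group G T R Mod K_kernel G T R c w"

definition K_action ::
  "('g, 'm) monoid_scheme \<Rightarrow> ('t, 'n) monoid_scheme \<Rightarrow> 't set \<Rightarrow> ('t set \<Rightarrow> 't) \<Rightarrow> ('g \<times> 't) list
    \<Rightarrow> 't \<Rightarrow> ('g, 't) L_elem set \<Rightarrow> ('g, 't) L_elem set" where
  "K_action G T R c w x = (\<lambda>C\<in>carrier (K_group G T R c w). L_action G T R c x ` C)"

definition K_bar ::
  "('g, 'm) monoid_scheme \<Rightarrow> ('t, 'n) monoid_scheme \<Rightarrow> 't set \<Rightarrow> ('t set \<Rightarrow> 't) \<Rightarrow> ('g \<times> 't) list
    \<Rightarrow> 't \<Rightarrow> ('g, 't) L_elem set" where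
  "K_bar G T R c w r = K_kernel G T R c w #>\<^bsub>L_group G T R\<^esub> L_bar G T R r"

definition K_copy ::
  "('g, 'm) monoid_scheme \<Rightarrow> ('t, 'n) monoid_scheme \<Rightarrow> 't set \<Rightarrow> ('t set \<Rightarrow> 't) \<Rightarrow> ('g \<times> 't) list
    \<Rightarrow> 't set \<Rightarrow> 'g \<Rightarrow> ('g, 't) L_elem set" where
  "K_copy G T R c w y g = K_kernel G T R c w #>\<^bsub>L_group G T R\<^esub> L_copy G T R y g"

section \<open>The construction is well defined\<close>

lemma free_product_generators:
  assumes "group A" "group B" "subgroup H (free_product A B)"
    and "\<And>a. a \<in> carrier A \<Longrightarrow> free_inl A B a \<in> H" "\<And>b. b \<in> carrier B \<Longrightarrow> free_inr A B b \<in> H"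
  shows "carrier (free_product A B) \<subseteq> H"
proof
  let ?A = "carrier A <+> carrier B" and ?\<rho> = "factor_rules Inl A \<union> factor_rules Inr B"
  interpret H: subgroup H "free_product A B" by fact
  fix x assume "x \<in> carrier (free_product A B)"
  then obtain w where "w \<in> lists ?A" and x: "x = word_class ?A ?\<rho> w"
    by (auto simp: free_product_def presented_carrier)
  then have "word_class ?A ?\<rho> w \<in> H"
  proof (induction w arbitrary: x)
    case Nil
    then show ?case using H.one_closed by (simp add: free_product_def presented_one)
  next
    case (Cons l w)
    have "word_class ?A ?\<rho> [l] \<in> H"
      using Cons.hyps(1) assms(4,5) by (auto simp: free_inl_def free_inr_def)
    then have "word_class ?A ?\<rho> [l] \<otimes>\<^bsub>free_product A B\<^esub> word_class ?A ?\<rho> w \<in> H"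
      using Cons.IH by (intro H.m_closed) simp_all
    moreover have "word_class ?A ?\<rho> [l] \<otimes>\<^bsub>free_product A B\<^esub> word_class ?A ?\<rho> w
        = word_class ?A ?\<rho> (l # w)"
      unfolding free_product_def using presented_mult[of "[l]" ?A w ?\<rho>] Cons.hyps by simp
    ultimately show ?case by simp
  qed
  with x show "x \<in> H" by simp
qed

lemma free_product_family_generators:
  assumes "\<And>i. i \<in> I \<Longrightarrow> group (F i)" "subgroup H (free_product_family I F)"
    and "\<And>i a. i \<in> I \<Longrightarrow> a \<in> carrier (F i) \<Longrightarrow> free_in I F i a \<in> H"
  shows "carrier (free_product_family I F) \<subseteq> H"
proof
  let ?A = "SIGMA i:I. carrier (F i)" and ?\<rho> = "\<Union>i\<in>I. factor_rules (Pair i) (F i)"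
  interpret H: subgroup H "free_product_family I F" by fact
  fix x assume "x \<in> carrier (free_product_family I F)"
  then obtain w where "w \<in> lists ?A" and x: "x = word_class ?A ?\<rho> w"
    by (auto simp: free_product_family_def presented_carrier)
  then have "word_class ?A ?\<rho> w \<in> H"
  proof (induction w arbitrary: x)
    case Nil
    then show ?case using H.one_closed by (simp add: free_product_family_def presented_one)
  next
    case (Cons l w)
    have "word_class ?A ?\<rho> [l] \<in> H"
      using Cons.hyps(1) assms(3) by (cases l) (auto simp: free_in_def)
    then have "word_class ?A ?\<rho> [l] \<otimes>\<^bsub>free_product_family I F\<^esub> word_class ?A ?\<rho> w \<in> H"
      using Cons.IH by (intro H.m_closed) simp_all
    moreover have "word_class ?A ?\<rho> [l] \<otimes>\<^bsub>free_product_family I F\<^esub> word_class ?A ?\<rho> w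
        = word_class ?A ?\<rho> (l # w)"
      unfolding free_product_family_def using presented_mult[of "[l]" ?A w ?\<rho>] Cons.hyps by simp
    ultimately show ?case by simp
  qed
  with x show "x \<in> H" by simp
qed

lemma factor_hom:
  assumes "group H" "factor_rules e H \<subseteq> \<rho>" "e ` carrier H \<subseteq> A"
  shows "(\<lambda>h. word_class A \<rho> [e h]) \<in> hom H (presented A \<rho>)"
proof (rule homI)
  interpret H: group H by fact
  have A: "[e a] \<in> lists A" if "a \<in> carrier H" for a
    using that assms(3) by auto
  then show "word_class A \<rho> [e a] \<in> carrier (presented A \<rho>)" if "a \<in> carrier H" for a
    unfolding presented_carrier using that by (intro imageI)
  fix a b assume ab: "a \<in> carrier H" "b \<in> carrier H"
  then have r: "([e a, e b], [e (a \<otimes>\<^bsub>H\<^esub> b)]) \<in> \<rho>"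
    using assms(2) by (auto simp: factor_rules_def)
  have "word_cong A \<rho> [e a, e b] [e (a \<otimes>\<^bsub>H\<^esub> b)]"
    using word_cong.rule[OF r, of A "[]" "[]"] ab A assms(3) by auto
  then show "word_class A \<rho> [e (a \<otimes>\<^bsub>H\<^esub> b)]
      = word_class A \<rho> [e a] \<otimes>\<^bsub>presented A \<rho>\<^esub> word_class A \<rho> [e b]"
    using presented_mult[of "[e a]" A "[e b]" \<rho>] A ab word_class_eqI by fastforce
qed

lemma free_inl_hom: "group A \<Longrightarrow> free_inl A B \<in> hom A (free_product A B)"
  unfolding free_product_def free_inl_def by (rule factor_hom) auto

lemma free_inr_hom: "group B \<Longrightarrow> free_inr A B \<in> hom B (free_product A B)"
  unfolding free_product_def free_inr_def by (rule factor_hom) auto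

lemma free_in_hom: "i \<in> I \<Longrightarrow> group (F i) \<Longrightarrow> free_in I F i \<in> hom (F i) (free_product_family I F)"
  unfolding free_product_family_def free_in_def by (rule factor_hom) auto

lemma (in group) mult_inv_cancel:
  assumes "y \<in> carrier G" "z \<in> carrier G"
  shows "y \<otimes> (inv y \<otimes> z) = z" "inv y \<otimes> (y \<otimes> z) = z"
  using assms by (simp_all add: m_assoc[symmetric])

lemma (in group) conj_by_hom: "y \<in> carrier G \<Longrightarrow> (\<lambda>x. conj_by G x y) \<in> hom G G"
  by (rule homI) (simp_all add: conj_by_def m_assoc mult_inv_cancel)

lemma (in group) normal_closure_normal:
  assumes "X \<subseteq> carrier G"
  shows "normal_closure G X \<lhd> G"
  unfolding normal_closure_def
proof (rule normal_generateI)
  show "{conj_by G x y |x y. x \<in> X \<and> y \<in> carrier G} \<subseteq> carrier G"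
    using assms by (auto simp: conj_by_def)
  fix h g assume "h \<in> {conj_by G x y |x y. x \<in> X \<and> y \<in> carrier G}" and g: "g \<in> carrier G"
  then obtain x y where xy: "x \<in> X" "y \<in> carrier G" "h = conj_by G x y" by blast
  then have "g \<otimes> h \<otimes> inv g = conj_by G x (y \<otimes> inv g)"
    using g assms by (auto simp: conj_by_def m_assoc inv_mult_group subsetD)
  then show "g \<otimes> h \<otimes> inv g \<in> {conj_by G x y |x y. x \<in> X \<and> y \<in> carrier G}"
    using xy g by blast
qed

lemma (in group) conj_by_conj_by:
  "x \<in> carrier G \<Longrightarrow> y \<in> carrier G \<Longrightarrow> z \<in> carrier G \<Longrightarrow>
    conj_by G (conj_by G x y) z = conj_by G x (y \<otimes> z)"
  by (simp add: conj_by_def m_assoc inv_mult_group)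

lemma (in group) conj_by_closed [simp, intro]:
  "x \<in> carrier G \<Longrightarrow> y \<in> carrier G \<Longrightarrow> conj_by G x y \<in> carrier G"
  by (simp add: conj_by_def)

lemma (in group_hom) conj_by_image:
  "x \<in> carrier G \<Longrightarrow> y \<in> carrier G \<Longrightarrow> h (conj_by G x y) = conj_by H (h x) (h y)"
  by (simp add: conj_by_def)

text \<open>The data of an amalgamated semidirect product. Injectivity of \<open>\<psi>\<close> plays no
  role in the formation of the quotient and is not required.\<close>

locale amalgam_data =
  fixes A :: "('a, 'm) monoid_scheme" and B :: "('b, 'n) monoid_scheme"
    and \<phi> :: "'a \<Rightarrow> 'b \<Rightarrow> 'b" and N :: "'a set" and \<psi> :: "'a \<Rightarrow> 'b"
  assumes group_A: "group A" and group_B: "group B" and normal_N: "N \<lhd> A"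
    and \<phi>_hom: "a \<in> carrier A \<Longrightarrow> \<phi> a \<in> hom B B"
    and \<phi>_mult: "a \<in> carrier A \<Longrightarrow> a' \<in> carrier A \<Longrightarrow> b \<in> carrier B \<Longrightarrow>
      \<phi> (a \<otimes>\<^bsub>A\<^esub> a') b = \<phi> a' (\<phi> a b)"
    and \<phi>_one: "b \<in> carrier B \<Longrightarrow> \<phi> \<one>\<^bsub>A\<^esub> b = b"
    and \<psi>_hom: "\<psi> \<in> hom (A\<lparr>carrier := N\<rparr>) B"
    and \<psi>_conj: "n \<in> N \<Longrightarrow> a \<in> carrier A \<Longrightarrow> \<psi> (conj_by A n a) = \<phi> a (\<psi> n)"
    and \<phi>_conj: "n \<in> N \<Longrightarrow> b \<in> carrier B \<Longrightarrow> \<phi> n b = conj_by B b (\<psi> n)"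
begin

sublocale A: group A by (rule group_A)
sublocale B: group B by (rule group_B)
sublocale N: normal N A by (rule normal_N)

lemma \<phi>_closed [simp, intro]: "a \<in> carrier A \<Longrightarrow> b \<in> carrier B \<Longrightarrow> \<phi> a b \<in> carrier B"
  using \<phi>_hom by (auto simp: hom_def)

lemma \<phi>_group_hom: "a \<in> carrier A \<Longrightarrow> group_hom B B (\<phi> a)"
  using \<phi>_hom by (simp add: group_hom_def group_hom_axioms_def group_B)

lemma \<psi>_group_hom: "group_hom (A\<lparr>carrier := N\<rparr>) B \<psi>"
  using \<psi>_hom N.subgroup_is_group[OF group_A]
  by (simp add: group_hom_def group_hom_axioms_def group_B)

lemma \<psi>_closed [simp, intro]: "n \<in> N \<Longrightarrow> \<psi> n \<in> carrier B"
  using \<psi>_hom by (auto simp: hom_def)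

lemma \<psi>_mult: "n \<in> N \<Longrightarrow> m \<in> N \<Longrightarrow> \<psi> (n \<otimes>\<^bsub>A\<^esub> m) = \<psi> n \<otimes>\<^bsub>B\<^esub> \<psi> m"
  using \<psi>_hom by (auto simp: hom_def)

lemma \<psi>_one: "\<psi> \<one>\<^bsub>A\<^esub> = \<one>\<^bsub>B\<^esub>"
  using group_hom.hom_one[OF \<psi>_group_hom] by simp

lemma \<phi>_Bmult: "a \<in> carrier A \<Longrightarrow> b \<in> carrier B \<Longrightarrow> b' \<in> carrier B \<Longrightarrow>
    \<phi> a (b \<otimes>\<^bsub>B\<^esub> b') = \<phi> a b \<otimes>\<^bsub>B\<^esub> \<phi> a b'"
  using \<phi>_hom by (auto simp: hom_def)

lemma \<phi>_Bone: "a \<in> carrier A \<Longrightarrow> \<phi> a \<one>\<^bsub>B\<^esub> = \<one>\<^bsub>B\<^esub>"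
  using group_hom.hom_one[OF \<phi>_group_hom] .

lemma \<phi>_Binv: "a \<in> carrier A \<Longrightarrow> b \<in> carrier B \<Longrightarrow> \<phi> a (inv\<^bsub>B\<^esub> b) = inv\<^bsub>B\<^esub> (\<phi> a b)"
  using group_hom.hom_inv[OF \<phi>_group_hom] .

lemma group_semidirect: "group (semidirect A B \<phi>)"
proof (rule groupI)
  fix x assume "x \<in> carrier (semidirect A B \<phi>)"
  then obtain a b where x: "x = (a, b)" "a \<in> carrier A" "b \<in> carrier B"
    by (auto simp: semidirect_def)
  have "\<phi> a (\<phi> (inv\<^bsub>A\<^esub> a) (inv\<^bsub>B\<^esub> b)) = inv\<^bsub>B\<^esub> b"
    using x \<phi>_mult[of "inv\<^bsub>A\<^esub> a" a "inv\<^bsub>B\<^esub> b"] \<phi>_one by simp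
  then show "\<exists>y\<in>carrier (semidirect A B \<phi>). y \<otimes>\<^bsub>semidirect A B \<phi>\<^esub> x = \<one>\<^bsub>semidirect A B \<phi>\<^esub>"
    using x by (intro bexI[of _ "(inv\<^bsub>A\<^esub> a, \<phi> (inv\<^bsub>A\<^esub> a) (inv\<^bsub>B\<^esub> b))"]) (auto simp: semidirect_def)
qed (auto simp: semidirect_def A.m_assoc B.m_assoc \<phi>_mult \<phi>_one \<phi>_Bmult \<phi>_Bone)

lemma amalgam_kernel_normal: "amalgam_kernel B N \<psi> \<lhd> semidirect A B \<phi>"
proof -
  let ?P = "semidirect A B \<phi>" and ?k = "\<lambda>n. (n, inv\<^bsub>B\<^esub> (\<psi> n))"
  interpret P: group ?P by (rule group_semidirect)
  have NA: "n \<in> carrier A" if "n \<in> N" for n using that N.subset by blast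
  have mult: "?k n \<otimes>\<^bsub>?P\<^esub> ?k m = ?k (n \<otimes>\<^bsub>A\<^esub> m)" if "n \<in> N" "m \<in> N" for n m
    using that by (simp add: semidirect_def \<phi>_conj conj_by_def \<psi>_mult B.inv_mult_group B.m_assoc)
  have one: "\<one>\<^bsub>?P\<^esub> = ?k \<one>\<^bsub>A\<^esub>" by (simp add: semidirect_def \<psi>_one)
  have inv: "inv\<^bsub>?P\<^esub> (?k n) = ?k (inv\<^bsub>A\<^esub> n)" if "n \<in> N" for n
  proof (rule P.inv_equality)
    show "?k (inv\<^bsub>A\<^esub> n) \<otimes>\<^bsub>?P\<^esub> ?k n = \<one>\<^bsub>?P\<^esub>"
      using mult[of "inv\<^bsub>A\<^esub> n" n] one that NA by simp
  qed (use that NA in \<open>auto simp: semidirect_def\<close>)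
  have sub: "subgroup (amalgam_kernel B N \<psi>) ?P"
  proof (rule P.subgroupI)
    show "amalgam_kernel B N \<psi> \<subseteq> carrier ?P"
      using NA by (auto simp: amalgam_kernel_def semidirect_def)
    show "amalgam_kernel B N \<psi> \<noteq> {}" using N.one_closed unfolding amalgam_kernel_def by blast
  next
    fix x assume "x \<in> amalgam_kernel B N \<psi>"
    then show "inv\<^bsub>?P\<^esub> x \<in> amalgam_kernel B N \<psi>"
      using inv by (auto simp: amalgam_kernel_def)
  next
    fix x y assume "x \<in> amalgam_kernel B N \<psi>" "y \<in> amalgam_kernel B N \<psi>"
    then show "x \<otimes>\<^bsub>?P\<^esub> y \<in> amalgam_kernel B N \<psi>"
      using mult by (fastforce simp: amalgam_kernel_def)
  qed
  have "x \<otimes>\<^bsub>?P\<^esub> ?k n \<otimes>\<^bsub>?P\<^esub> inv\<^bsub>?P\<^esub> x \<in> amalgam_kernel B N \<psi>"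
    if x: "x \<in> carrier ?P" and n: "n \<in> N" for x n
  proof -
    from x obtain a b where ab: "x = (a, b)" "a \<in> carrier A" "b \<in> carrier B"
      by (auto simp: semidirect_def)
    let ?m = "a \<otimes>\<^bsub>A\<^esub> n \<otimes>\<^bsub>A\<^esub> inv\<^bsub>A\<^esub> a"
    have m: "?m \<in> N" using N.inv_op_closed2 ab n by blast
    have "conj_by A ?m a = n"
      using ab NA[OF n] by (simp add: conj_by_def A.m_assoc A.mult_inv_cancel)
    then have "\<phi> a (\<psi> ?m) = \<psi> n" using \<psi>_conj[OF m ab(2)] by simp
    then have "x \<otimes>\<^bsub>?P\<^esub> ?k n = ?k ?m \<otimes>\<^bsub>?P\<^esub> x"
      using ab n m NA[OF n]
      by (simp add: semidirect_def \<phi>_conj conj_by_def \<phi>_Binv B.m_assoc A.m_assoc)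
    moreover have "?k ?m \<in> carrier ?P" using NA[OF m] m by (simp add: semidirect_def)
    ultimately have "x \<otimes>\<^bsub>?P\<^esub> ?k n \<otimes>\<^bsub>?P\<^esub> inv\<^bsub>?P\<^esub> x = ?k ?m"
      using x by (simp add: P.m_assoc)
    then show ?thesis using m by (auto simp: amalgam_kernel_def)
  qed
  then show ?thesis
    by (intro P.normal_invI[OF sub]) (auto simp: amalgam_kernel_def)
qed

lemma group_amalgamated: "group (amalgamated_semidirect A B \<phi> N \<psi>)"
  unfolding amalgamated_semidirect_def
  by (rule normal.factorgroup_is_group[OF amalgam_kernel_normal])

end

locale relative_setting =
  fixes G :: "('g, 'm) monoid_scheme" and T :: "('t, 'n) monoid_scheme"
    and R :: "'t set" and c :: "'t set \<Rightarrow> 't"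
  assumes group_G: "group G" and normal_R: "R \<lhd> T" and transv: "transversal T R c"
begin

lemma group_T: "group T" using normal_R by (simp add: normal_def)

sublocale T: group T by (rule group_T)

sublocale R: normal R T by (rule normal_R)

abbreviation "L \<equiv> L_group G T R"
abbreviation "bar \<equiv> L_bar G T R"
abbreviation "copy \<equiv> L_copy G T R"
abbreviation "act \<equiv> L_action G T R c"
abbreviation "cosets \<equiv> carrier (T Mod R)"

lemma group_R: "group (T\<lparr>carrier := R\<rparr>)"
  using R.subgroup_is_group group_T by blast

lemma group_L: "group L"
  unfolding L_group_def
  by (intro group_free_product group_free_product_family group_R group_G)

sublocale L: group L by (rule group_L)

lemma bar_hom: "bar \<in> hom (T\<lparr>carrier := R\<rparr>) L"
  unfolding L_bar_def L_group_def by (rule free_inl_hom[OF group_R])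

lemma copy_hom: "y \<in> cosets \<Longrightarrow> copy y \<in> hom G L"
  unfolding L_copy_def L_group_def
  using hom_compose[OF free_in_hom free_inr_hom, of y cosets "\<lambda>_. G"] group_G
  by (auto simp: comp_def group_free_product_family)

lemma bar_closed [simp, intro]: "r \<in> R \<Longrightarrow> bar r \<in> carrier L"
  using bar_hom by (auto simp: hom_def)

lemma copy_closed [simp, intro]: "y \<in> cosets \<Longrightarrow> g \<in> carrier G \<Longrightarrow> copy y g \<in> carrier L"
  using copy_hom[of y] by (auto simp: hom_def)

lemma bar_mult: "r \<in> R \<Longrightarrow> s \<in> R \<Longrightarrow> bar (r \<otimes>\<^bsub>T\<^esub> s) = bar r \<otimes>\<^bsub>L\<^esub> bar s"
  using bar_hom by (auto simp: hom_def)

lemma bar_one: "bar \<one>\<^bsub>T\<^esub> = \<one>\<^bsub>L\<^esub>"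
  using hom_one[OF bar_hom group_R group_L] by simp

lemma bar_inv: "r \<in> R \<Longrightarrow> bar (inv\<^bsub>T\<^esub> r) = inv\<^bsub>L\<^esub> (bar r)"
  by (metis R.m_inv_closed R.mem_carrier L.inv_equality T.l_inv bar_closed bar_mult bar_one)

lemma L_generators:
  assumes "subgroup H L" "\<And>r. r \<in> R \<Longrightarrow> bar r \<in> H"
    "\<And>y g. y \<in> cosets \<Longrightarrow> g \<in> carrier G \<Longrightarrow> copy y g \<in> H"
  shows "carrier L \<subseteq> H"
proof -
  let ?R = "T\<lparr>carrier := R\<rparr>" and ?F = "free_product_family cosets (\<lambda>_. G)"
  have F: "group ?F" by (rule group_free_product_family[OF group_G])
  have h: "group_hom ?F L (free_inr ?R ?F)"
    using F group_L free_inr_hom[OF F] by (simp add: group_hom_def group_hom_axioms_def L_group_def)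
  have sub: "subgroup {b \<in> carrier ?F. free_inr ?R ?F b \<in> H} ?F"
  proof -
    interpret group_hom ?F L "free_inr ?R ?F" by (rule h)
    interpret H': subgroup H L by fact
    show ?thesis by (rule G.subgroupI) auto
  qed
  have "carrier ?F \<subseteq> {b \<in> carrier ?F. free_inr ?R ?F b \<in> H}"
  proof (rule free_product_family_generators[OF group_G sub])
    fix y g assume "y \<in> cosets" "g \<in> carrier G"
    then show "free_in cosets (\<lambda>_. G) y g \<in> {b \<in> carrier ?F. free_inr ?R ?F b \<in> H}"
      using assms(3)[of y g] free_in_hom[of y cosets "\<lambda>_. G"] group_G
      by (auto simp: L_copy_def hom_def)
  qed
  then show ?thesis
    using free_product_generators[OF group_R F, of H] assms(1,2)
    unfolding L_group_def L_bar_def by auto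
qed

lemma L_hom_eqI:
  assumes "h \<in> hom L H" "h' \<in> hom L H" "group H" "x \<in> carrier L"
    and "\<And>r. r \<in> R \<Longrightarrow> h (bar r) = h' (bar r)"
    and "\<And>y g. y \<in> cosets \<Longrightarrow> g \<in> carrier G \<Longrightarrow> h (copy y g) = h' (copy y g)"
  shows "h x = h' x"
proof -
  interpret h: group_hom L H h
    using assms(1,3) by (simp add: group_hom_def group_hom_axioms_def)
  interpret h': group_hom L H h'
    using assms(2,3) by (simp add: group_hom_def group_hom_axioms_def)
  have "subgroup {x \<in> carrier L. h x = h' x} L"
    by (rule L.subgroupI) (use h.hom_one h'.hom_one in auto)
  then have "carrier L \<subseteq> {x \<in> carrier L. h x = h' x}"
    by (rule L_generators) (use assms(5,6) in auto)
  with assms(4) show ?thesis by blast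
qed

lemma coset_act:
  assumes "y \<in> cosets" "x \<in> carrier T"
  shows "y #>\<^bsub>T\<^esub> x \<in> cosets"
    and "c y \<in> carrier T"
    and "y = R #>\<^bsub>T\<^esub> c y"
    and "inv\<^bsub>T\<^esub> (c (y #>\<^bsub>T\<^esub> x)) \<otimes>\<^bsub>T\<^esub> c y \<otimes>\<^bsub>T\<^esub> x \<in> R"
proof -
  have *: "z = R #>\<^bsub>T\<^esub> c z \<and> c z \<in> carrier T" if "z \<in> cosets" for z
  proof -
    from that obtain u where u: "u \<in> carrier T" "z = R #>\<^bsub>T\<^esub> u"
      by (auto simp: FactGroup_def RCOSETS_def)
    moreover have "c z \<in> z" using that transv by (simp add: transversal_def)
    ultimately show ?thesis
      using T.repr_independence[of "c z" R u] R.subgroup_axioms T.r_coset_subset_G[OF R.subset] by blast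
  qed
  show y: "y = R #>\<^bsub>T\<^esub> c y" "c y \<in> carrier T" using *[OF assms(1)] by auto
  then have yx: "y #>\<^bsub>T\<^esub> x = R #>\<^bsub>T\<^esub> (c y \<otimes>\<^bsub>T\<^esub> x)"
    using T.coset_mult_assoc[OF R.subset y(2) assms(2)] by simp
  then show 1: "y #>\<^bsub>T\<^esub> x \<in> cosets"
    using y(2) assms(2) by (auto simp: FactGroup_def RCOSETS_def)
  let ?u = "c y \<otimes>\<^bsub>T\<^esub> x" and ?z = "y #>\<^bsub>T\<^esub> x"
  have "?u \<in> R #>\<^bsub>T\<^esub> c ?z"
    using *[OF 1] yx T.rcos_self[of ?u R] R.subgroup_axioms y(2) assms(2) by auto
  then have "?u \<in> c ?z <#\<^bsub>T\<^esub> R"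
    using R.coset_eq *[OF 1] by blast
  then obtain r where r: "r \<in> R" "?u = c ?z \<otimes>\<^bsub>T\<^esub> r"
    by (auto simp: l_coset_def)
  then have "inv\<^bsub>T\<^esub> (c ?z) \<otimes>\<^bsub>T\<^esub> ?u = r"
    using *[OF 1] R.subset by (simp add: T.inv_solve_left' subsetD)
  then show "inv\<^bsub>T\<^esub> (c ?z) \<otimes>\<^bsub>T\<^esub> c y \<otimes>\<^bsub>T\<^esub> x \<in> R"
    using r(1) *[OF 1] y(2) assms(2) by (simp add: T.m_assoc)
qed

lemma conj_R: "r \<in> R \<Longrightarrow> x \<in> carrier T \<Longrightarrow> conj_by T r x \<in> R"
  using R.inv_op_closed1 by (simp add: conj_by_def)

lemma L_action_generators:
  assumes x: "x \<in> carrier T"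
  shows "act x \<in> hom L L"
    and "r \<in> R \<Longrightarrow> act x (bar r) = bar (conj_by T r x)"
    and "y \<in> cosets \<Longrightarrow> g \<in> carrier G \<Longrightarrow> act x (copy y g) =
      conj_by L (copy (y #>\<^bsub>T\<^esub> x) g) (bar (inv\<^bsub>T\<^esub> (c (y #>\<^bsub>T\<^esub> x)) \<otimes>\<^bsub>T\<^esub> c y \<otimes>\<^bsub>T\<^esub> x))"
proof -
  let ?R = "T\<lparr>carrier := R\<rparr>" and ?F = "free_product_family cosets (\<lambda>_. G)"
  let ?f = "\<lambda>r. bar (conj_by T r x)"
  let ?g = "\<lambda>y g. conj_by L (copy (y #>\<^bsub>T\<^esub> x) g)
             (bar (inv\<^bsub>T\<^esub> (c (y #>\<^bsub>T\<^esub> x)) \<otimes>\<^bsub>T\<^esub> c y \<otimes>\<^bsub>T\<^esub> x))"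
  have F: "group ?F" by (rule group_free_product_family[OF group_G])
  have f: "?f \<in> hom ?R L"
  proof (rule homI)
    show "?f r \<in> carrier L" if "r \<in> carrier ?R" for r
      using that conj_R[OF _ x] by simp
    fix r s assume "r \<in> carrier ?R" "s \<in> carrier ?R"
    then show "?f (r \<otimes>\<^bsub>?R\<^esub> s) = ?f r \<otimes>\<^bsub>L\<^esub> ?f s"
      using conj_R[OF _ x] hom_mult[OF T.conj_by_hom[OF x], of r s] R.subset
      by (simp add: bar_mult[symmetric] subsetD)
  qed
  have g: "?g y \<in> hom G L" if "y \<in> cosets" for y
    using hom_compose[OF copy_hom[OF coset_act(1)[OF that x]]
        L.conj_by_hom[OF bar_closed[OF coset_act(4)[OF that x]]]]
    by (simp add: comp_def)
  note fam = lift_free_product_family[where F = "\<lambda>_. G" and I = cosets and f = ?g, OF group_G group_L g]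
  note fp = lift_free_product[OF group_R F group_L f fam(1)]
  have act: "act x = restrict (lift L (case_sum ?f (lift L (case_prod ?g)))) (carrier L)"
    by (simp add: L_action_def)
  have "lift L (case_sum ?f (lift L (case_prod ?g))) \<in> hom L L"
    using fp(1) by (simp add: L_group_def)
  then show "act x \<in> hom L L"
    unfolding act by (auto simp: hom_def restrict_def)
  show "act x (bar r) = bar (conj_by T r x)" if "r \<in> R"
    using fp(2)[of r] that bar_closed[OF that] unfolding act by (simp add: L_bar_def)
  show "act x (copy y g) = ?g y g" if "y \<in> cosets" "g \<in> carrier G"
  proof -
    have "free_in cosets (\<lambda>_. G) y g \<in> carrier ?F"
      using free_in_hom[of y cosets "\<lambda>_. G"] group_G that by (auto simp: hom_def)
    then show ?thesis
      using fp(3) fam(2) that copy_closed[OF that] unfolding act by (simp add: L_copy_def)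
  qed
qed

lemma act_closed [simp, intro]: "x \<in> carrier T \<Longrightarrow> u \<in> carrier L \<Longrightarrow> act x u \<in> carrier L"
  using L_action_generators(1) by (auto simp: hom_def)

lemma act_group_hom: "x \<in> carrier T \<Longrightarrow> group_hom L L (act x)"
  using L_action_generators(1) by (simp add: group_hom_def group_hom_axioms_def group_L)

lemma act_mult:
  assumes "x \<in> carrier T" "x' \<in> carrier T" "u \<in> carrier L"
  shows "act (x \<otimes>\<^bsub>T\<^esub> x') u = act x' (act x u)"
proof -
  have xx: "x \<otimes>\<^bsub>T\<^esub> x' \<in> carrier T" using assms by simp
  interpret a: group_hom L L "act x'" by (rule act_group_hom[OF assms(2)])
  note gen = L_action_generators(2,3)
  have "act (x \<otimes>\<^bsub>T\<^esub> x') u = (act x' \<circ> act x) u"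
  proof (rule L_hom_eqI[OF _ _ group_L assms(3)])
    show "act (x \<otimes>\<^bsub>T\<^esub> x') \<in> hom L L" by (rule L_action_generators(1)[OF xx])
    show "act x' \<circ> act x \<in> hom L L"
      by (rule hom_compose[OF L_action_generators(1)[OF assms(1)] L_action_generators(1)[OF assms(2)]])
  next
    fix r assume "r \<in> R"
    then show "act (x \<otimes>\<^bsub>T\<^esub> x') (bar r) = (act x' \<circ> act x) (bar r)"
      using assms by (simp add: gen conj_R T.conj_by_conj_by xx)
  next
    fix y g assume y: "y \<in> cosets" and g: "g \<in> carrier G"
    let ?z = "y #>\<^bsub>T\<^esub> x" and ?v = "y #>\<^bsub>T\<^esub> x #>\<^bsub>T\<^esub> x'"
    let ?a = "inv\<^bsub>T\<^esub> (c ?z) \<otimes>\<^bsub>T\<^esub> c y \<otimes>\<^bsub>T\<^esub> x" and ?a' = "inv\<^bsub>T\<^esub> (c ?v) \<otimes>\<^bsub>T\<^esub> c ?z \<otimes>\<^bsub>T\<^esub> x'"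
    have z: "?z \<in> cosets" using coset_act(1)[OF y assms(1)] .
    have v: "?v \<in> cosets" using coset_act(1)[OF z assms(2)] .
    note cT = coset_act(2)[OF y T.one_closed] coset_act(2)[OF z T.one_closed] coset_act(2)[OF v T.one_closed]
    have "y \<subseteq> carrier T"
      using coset_act(2,3)[OF y T.one_closed] T.r_coset_subset_G[OF R.subset] by metis
    then have v': "y #>\<^bsub>T\<^esub> (x \<otimes>\<^bsub>T\<^esub> x') = ?v"
      using T.coset_mult_assoc assms by simp
    have a: "?a \<in> R" "?a' \<in> R" using coset_act(4) y z assms by auto
    have "act x' (act x (copy y g)) = conj_by L (act x' (copy ?z g)) (act x' (bar ?a))"
      using gen(2)[OF assms(1) y g] a.conj_by_image[OF copy_closed[OF z g] bar_closed[OF a(1)]] by simp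
    also have "\<dots> = conj_by L (conj_by L (copy ?v g) (bar ?a')) (bar (conj_by T ?a x'))"
      using gen(2)[OF assms(2) z g] gen(1)[OF assms(2) a(1)] by simp
    also have "\<dots> = conj_by L (copy ?v g) (bar (?a' \<otimes>\<^bsub>T\<^esub> conj_by T ?a x'))"
      using L.conj_by_conj_by[OF copy_closed[OF v g] bar_closed[OF a(2)] bar_closed[OF conj_R[OF a(1) assms(2)]]]
        bar_mult[OF a(2) conj_R[OF a(1) assms(2)]] by simp
    also have "?a' \<otimes>\<^bsub>T\<^esub> conj_by T ?a x' = inv\<^bsub>T\<^esub> (c ?v) \<otimes>\<^bsub>T\<^esub> c y \<otimes>\<^bsub>T\<^esub> (x \<otimes>\<^bsub>T\<^esub> x')"
      using cT assms(1,2) by (simp add: conj_by_def T.m_assoc T.mult_inv_cancel)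
    finally show "act (x \<otimes>\<^bsub>T\<^esub> x') (copy y g) = (act x' \<circ> act x) (copy y g)"
      using gen(2)[OF xx y g] v' by simp
  qed
  then show ?thesis by simp
qed

text \<open>An element of \<open>R\<close> acts as conjugation by its copy.\<close>

lemma L_action_conj:
  assumes "r \<in> R" "u \<in> carrier L"
  shows "act r u = conj_by L u (bar r)"
proof -
  have rT: "r \<in> carrier T" using assms(1) R.subset by blast
  show ?thesis
  proof (rule L_hom_eqI[OF L_action_generators(1)[OF rT] L.conj_by_hom[OF bar_closed[OF assms(1)]]
        group_L assms(2)])
    fix s assume "s \<in> R"
    then show "act r (bar s) = conj_by L (bar s) (bar r)"
      using L_action_generators(2)[OF rT] assms(1)
      by (simp add: conj_by_def bar_mult bar_inv)
  next
    fix y g assume y: "y \<in> cosets" and g: "g \<in> carrier G"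
    note cy = coset_act(2,3)[OF y T.one_closed]
    have "y #>\<^bsub>T\<^esub> r = c y <#\<^bsub>T\<^esub> R #>\<^bsub>T\<^esub> r"
      using cy R.coset_eq by simp
    also have "\<dots> = c y <#\<^bsub>T\<^esub> (R #>\<^bsub>T\<^esub> r)"
      by (simp add: T.coset_assoc[OF cy(1) rT R.subset])
    also have "R #>\<^bsub>T\<^esub> r = R"
      using T.coset_join2[OF rT R.subgroup_axioms assms(1)] .
    also have "c y <#\<^bsub>T\<^esub> R = y"
      using cy R.coset_eq by simp
    finally have "y #>\<^bsub>T\<^esub> r = y" .
    then show "act r (copy y g) = conj_by L (copy y g) (bar r)"
      using L_action_generators(3)[OF rT y g] cy(1) rT by simp
  qed
qed

lemma act_one: "u \<in> carrier L \<Longrightarrow> act \<one>\<^bsub>T\<^esub> u = u"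
  using L_action_conj[OF R.one_closed] by (simp add: conj_by_def bar_one)

context
  fixes w :: "('g \<times> 't) list"
  assumes w: "set w \<subseteq> carrier G \<times> carrier T" and t: "T_product T w \<in> R"
begin

lemma tail_product_closed: "tail_product T w i \<in> carrier T"
  unfolding tail_product_def T_product_def
  using w by (intro T.list_prod_closed) (auto dest: in_set_dropD)

lemma tail_coset_closed: "tail_coset T R w i \<in> cosets"
  using tail_product_closed by (auto simp: tail_coset_def FactGroup_def RCOSETS_def)

lemma tail_rem_closed: "tail_rem T R c w i \<in> R"
proof -
  have R: "R \<in> cosets" and cR: "c R = \<one>\<^bsub>T\<^esub>"
    using T.coset_mult_one[OF R.subset] transv
    by (auto simp: FactGroup_def RCOSETS_def transversal_def)
  show ?thesis
    using coset_act(4)[OF R tail_product_closed[of i]] coset_act(2)[OF tail_coset_closed T.one_closed]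
      tail_product_closed cR by (simp add: tail_rem_def tail_coset_def)
qed

lemma L_relator_closed: "L_relator G T R c w \<in> carrier L"
  unfolding L_relator_def
proof (intro L.m_closed bar_closed t L.list_prod_closed subsetI)
  fix z assume "z \<in> set (map (\<lambda>i. conj_by L (copy (tail_coset T R w i) (fst (w ! i)))
      (bar (tail_rem T R c w i))) [0..<length w])"
  then obtain i where "i < length w" and z: "z = conj_by L (copy (tail_coset T R w i) (fst (w ! i)))
      (bar (tail_rem T R c w i))" by auto
  then have "w ! i \<in> set w" by simp
  then have "fst (w ! i) \<in> carrier G" using w by auto
  then show "z \<in> carrier L"
    unfolding z by (intro L.conj_by_closed copy_closed bar_closed tail_coset_closed tail_rem_closed)
qed

lemma L1_subgroup: "subgroup (L1_sub G T R w) L"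
  unfolding L1_sub_def by (rule L.generate_is_subgroup) (auto intro: tail_coset_closed)

lemma L_relator_L1: "L_relator G T R c w \<in> L1_sub G T R w"
proof -
  interpret L1: subgroup "L1_sub G T R w" L by (rule L1_subgroup)
  have bar: "bar r \<in> L1_sub G T R w" if "r \<in> R" for r
    using that unfolding L1_sub_def by (intro generate.incl) blast
  have copy: "copy (tail_coset T R w i) (fst (w ! i)) \<in> L1_sub G T R w" if "i < length w" for i
  proof -
    have "fst (w ! i) \<in> carrier G" using w nth_mem[OF that] by auto
    then show ?thesis using that unfolding L1_sub_def by (intro generate.incl) blast
  qed
  have prod: "list_prod L xs \<in> L1_sub G T R w" if "set xs \<subseteq> L1_sub G T R w" for xs
    using that by (induction xs) (auto simp: list_prod_def)
  moreover have "conj_by L (copy (tail_coset T R w i) (fst (w ! i))) (bar (tail_rem T R c w i))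
      \<in> L1_sub G T R w" if "i < length w" for i
    unfolding conj_by_def
    by (intro L1.m_closed L1.m_inv_closed copy bar tail_rem_closed that)
  ultimately show ?thesis
    unfolding L_relator_def by (intro L1.m_closed bar t) (auto intro!: prod)
qed

lemma N1_subset: "N1_sub G T R c w \<subseteq> carrier L"
proof -
  interpret L1: group "L\<lparr>carrier := L1_sub G T R w\<rparr>"
    using L1_subgroup group_L by (rule subgroup.subgroup_is_group)
  have "N1_sub G T R c w \<lhd> L\<lparr>carrier := L1_sub G T R w\<rparr>"
    unfolding N1_sub_def by (rule L1.normal_closure_normal) (use L_relator_L1 in simp)
  then have "N1_sub G T R c w \<subseteq> L1_sub G T R w"
    using subgroup.subset[of "N1_sub G T R c w" "L\<lparr>carrier := L1_sub G T R w\<rparr>"]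
    by (simp add: normal_def)
  then show ?thesis using subgroup.subset[OF L1_subgroup] by blast
qed

abbreviation "M \<equiv> K_kernel G T R c w"
abbreviation "K \<equiv> K_group G T R c w"

lemma N_subset: "y \<in> cosets \<Longrightarrow> N_sub G T R c w y \<subseteq> carrier L"
  using N1_subset coset_act(2)[OF _ T.one_closed] by (auto simp: N_sub_def)

lemma K_kernel_normal: "M \<lhd> L"
  unfolding K_kernel_def by (rule L.normal_closure_normal) (use N_subset in blast)

lemma act_K_kernel_subset:
  assumes x: "x \<in> carrier T"
  shows "act x ` M \<subseteq> M"
proof -
  interpret M: normal M L by (rule K_kernel_normal)
  interpret a: group_hom L L "act x" by (rule act_group_hom[OF x])
  let ?X = "\<Union>y\<in>cosets. N_sub G T R c w y"
  let ?C = "{conj_by L u v |u v. u \<in> ?X \<and> v \<in> carrier L}"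
  have C: "?C \<subseteq> carrier L" using N_subset by blast
  have conjM: "conj_by L u v \<in> M" if "u \<in> M" "v \<in> carrier L" for u v
    using that M.inv_op_closed1 by (simp add: conj_by_def)
  have XM: "u \<in> M" if "u \<in> ?X" for u
  proof -
    have "u \<in> carrier L" using that N_subset by blast
    then have "u = conj_by L u \<one>\<^bsub>L\<^esub>" by (simp add: conj_by_def)
    then have "u \<in> ?C" using that by blast
    then show ?thesis unfolding K_kernel_def normal_closure_def by (rule generate.incl)
  qed
  have XX: "act x u \<in> M" if u: "u \<in> ?X" for u
  proof -
    from u obtain y n where y: "y \<in> cosets" and n: "n \<in> N1_sub G T R c w" "u = act (c y) n"
      by (auto simp: N_sub_def)
    let ?z = "y #>\<^bsub>T\<^esub> x" and ?a = "inv\<^bsub>T\<^esub> (c (y #>\<^bsub>T\<^esub> x)) \<otimes>\<^bsub>T\<^esub> c y \<otimes>\<^bsub>T\<^esub> x"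
    have z: "?z \<in> cosets" and a: "?a \<in> R" and cy: "c y \<in> carrier T" using coset_act[OF y x] by auto
    have cz: "c ?z \<in> carrier T" using coset_act(2)[OF z x] .
    have nL: "n \<in> carrier L" using n N1_subset by blast
    have e: "c y \<otimes>\<^bsub>T\<^esub> x = c ?z \<otimes>\<^bsub>T\<^esub> ?a" using cz cy x by (simp add: T.m_assoc T.mult_inv_cancel)
    have "act x u = act (c y \<otimes>\<^bsub>T\<^esub> x) n" using act_mult[OF cy x nL] n by simp
    also have "\<dots> = act ?a (act (c ?z) n)"
      unfolding e using act_mult[OF cz _ nL, of ?a] a R.subset by blast
    also have "\<dots> = conj_by L (act (c ?z) n) (bar ?a)"
      using L_action_conj[OF a] cz nL by simp
    finally have "act x u = conj_by L (act (c ?z) n) (bar ?a)" .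
    moreover have "act (c ?z) n \<in> M" using XM z n by (auto simp: N_sub_def)
    ultimately show ?thesis using conjM a by simp
  qed
  have "act x (conj_by L u v) \<in> M" if "u \<in> ?X" "v \<in> carrier L" for u v
  proof -
    have "u \<in> carrier L" using that(1) N_subset by blast
    then have "act x (conj_by L u v) = conj_by L (act x u) (act x v)"
      using a.conj_by_image that(2) by simp
    moreover have "conj_by L (act x u) (act x v) \<in> M"
      using XX[OF that(1)] that(2) x by (intro conjM) auto
    ultimately show ?thesis by simp
  qed
  then have "act x ` ?C \<subseteq> M" by blast
  then have "generate L (act x ` ?C) \<subseteq> M"
    by (rule L.generate_subgroup_incl) (rule M.subgroup_axioms)
  moreover have "act x ` M = generate L (act x ` ?C)"
    unfolding K_kernel_def normal_closure_def by (rule a.generate_img[OF C, symmetric])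
  ultimately show ?thesis by simp
qed

lemma act_K_kernel:
  assumes "x \<in> carrier T"
  shows "act x ` M = M"
proof
  show "act x ` M \<subseteq> M" by (rule act_K_kernel_subset[OF assms])
  show "M \<subseteq> act x ` M"
  proof
    fix u assume u: "u \<in> M"
    then have uL: "u \<in> carrier L" using K_kernel_normal by (auto simp: normal_def dest: subgroup.subset)
    have "act (inv\<^bsub>T\<^esub> x) u \<in> M" using act_K_kernel_subset[of "inv\<^bsub>T\<^esub> x"] assms u by auto
    moreover have "u = act x (act (inv\<^bsub>T\<^esub> x) u)"
      using act_mult[of "inv\<^bsub>T\<^esub> x" x u] act_one assms uL by simp
    ultimately show "u \<in> act x ` M" by blast
  qed
qed

lemma group_K: "group K"
  unfolding K_group_def by (rule normal.factorgroup_is_group[OF K_kernel_normal])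

lemma K_action_coset:
  assumes x: "x \<in> carrier T" and u: "u \<in> carrier L"
  shows "K_action G T R c w x (M #>\<^bsub>L\<^esub> u) = M #>\<^bsub>L\<^esub> act x u"
proof -
  interpret a: group_hom L L "act x" by (rule act_group_hom[OF x])
  interpret M: normal M L by (rule K_kernel_normal)
  have "act x ` (M #>\<^bsub>L\<^esub> u) = (\<lambda>m. act x m \<otimes>\<^bsub>L\<^esub> act x u) ` M"
    using u M.subset by (auto simp: r_coset_def image_iff subsetD)
  also have "\<dots> = act x ` M #>\<^bsub>L\<^esub> act x u"
    by (auto simp: r_coset_def)
  finally show ?thesis
    using u act_K_kernel[OF x]
    by (simp add: K_action_def K_group_def FactGroup_def L.rcosetsI M.subset)
qed

lemma K_carrier: "C \<in> carrier K \<Longrightarrow> \<exists>u\<in>carrier L. C = M #>\<^bsub>L\<^esub> u"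
  by (auto simp: K_group_def FactGroup_def RCOSETS_def)

lemma K_proj_hom: "(\<lambda>u. M #>\<^bsub>L\<^esub> u) \<in> hom L K"
  unfolding K_group_def by (rule normal.r_coset_hom_Mod[OF K_kernel_normal])

lemma K_amalgam_data: "amalgam_data T K (K_action G T R c w) R (K_bar G T R c w)"
proof (rule amalgam_data.intro)
  show "group T" "group K" "R \<lhd> T" by (rule group_T group_K normal_R)+
  interpret p: group_hom L K "\<lambda>u. M #>\<^bsub>L\<^esub> u"
    using K_proj_hom by (simp add: group_hom_def group_hom_axioms_def group_L group_K)
  show "K_action G T R c w x \<in> hom K K" if x: "x \<in> carrier T" for x
  proof (rule homI)
    fix C assume "C \<in> carrier K"
    then obtain u where "u \<in> carrier L" "C = M #>\<^bsub>L\<^esub> u" using K_carrier by blast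
    then show "K_action G T R c w x C \<in> carrier K" using K_action_coset[OF x] x by simp
  next
    interpret a: group_hom L L "act x" by (rule act_group_hom[OF x])
    fix C D assume "C \<in> carrier K" "D \<in> carrier K"
    then obtain u v where uv: "u \<in> carrier L" "C = M #>\<^bsub>L\<^esub> u" "v \<in> carrier L" "D = M #>\<^bsub>L\<^esub> v"
      using K_carrier by meson
    then show "K_action G T R c w x (C \<otimes>\<^bsub>K\<^esub> D) = K_action G T R c w x C \<otimes>\<^bsub>K\<^esub> K_action G T R c w x D"
      using K_action_coset[OF x] x by (simp add: p.hom_mult[symmetric] del: p.hom_mult)
  qed
  show "K_action G T R c w (x \<otimes>\<^bsub>T\<^esub> x') C = K_action G T R c w x' (K_action G T R c w x C)"
    if "x \<in> carrier T" "x' \<in> carrier T" "C \<in> carrier K" for x x' C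
    using K_carrier[OF that(3)] that(1,2) act_mult K_action_coset by fastforce
  show "K_action G T R c w \<one>\<^bsub>T\<^esub> C = C" if "C \<in> carrier K" for C
    using K_carrier[OF that] act_one K_action_coset by fastforce
  show "K_bar G T R c w \<in> hom (T\<lparr>carrier := R\<rparr>) K"
    using hom_compose[OF bar_hom K_proj_hom] by (simp add: K_bar_def[abs_def] comp_def)
  show "K_bar G T R c w (conj_by T n x) = K_action G T R c w x (K_bar G T R c w n)"
    if "n \<in> R" "x \<in> carrier T" for n x
    using that by (simp add: K_bar_def K_action_coset L_action_generators(2))
  show "K_action G T R c w n C = conj_by K C (K_bar G T R c w n)" if "n \<in> R" "C \<in> carrier K" for n C
  proof -
    obtain u where "u \<in> carrier L" "C = M #>\<^bsub>L\<^esub> u" using K_carrier[OF \<open>C \<in> carrier K\<close>] by blast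
    moreover have "n \<in> carrier T" using that(1) R.subset by blast
    ultimately show ?thesis
      using that p.conj_by_image[of u "bar n"]
      by (simp add: K_bar_def K_action_coset L_action_conj)
  qed
qed

end

end

end

theory Submission
  imports Defs
begin

text \<open>In any group containing images of \<open>G\<close> and \<open>T\<close>, moving all letters of \<open>T\<close> to the left rewrites
  \<open>g\<^sub>1 t\<^sub>1 \<dots> g\<^sub>q t\<^sub>q\<close> as \<open>t\<close> times the product of the conjugates of the \<open>g\<^sub>i\<close> by \<open>t\<^sub>i \<dots> t\<^sub>q\<close>. Applied in \<open>P\<close>, this
  identifies the image of \<open>w\<close> with the relator of \<open>K\<close> and yields a homomorphism from the one-relator
  quotient to \<open>P\<close>; applied in the quotient, it shows that \<open>L\<close> maps there with the \<open>y\<close>-th copy of \<open>g\<close> going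
  to the conjugate of \<open>g\<close> by \<open>c\<^sub>y\<close>, that this map factors through \<open>K\<close>, and, being equivariant, extends
  to \<open>P\<close>. On generators the two homomorphisms are mutually inverse.\<close>

section \<open>Normal closures, list products and the rewriting of a word\<close>

lemma (in group) normal_closure_incl:
  assumes "X \<subseteq> carrier G"
  shows "X \<subseteq> normal_closure G X"
proof
  fix x assume "x \<in> X"
  moreover from this have "x = conj_by G x \<one>" using assms by (auto simp: conj_by_def)
  ultimately show "x \<in> normal_closure G X"
    unfolding normal_closure_def by (intro generate.incl) blast
qed

lemma (in group) normal_conj_by:
  assumes "N \<lhd> G" "x \<in> N" "y \<in> carrier G"
  shows "conj_by G x y \<in> N"
  using normal.inv_op_closed1[OF assms(1,3,2)] by (simp add: conj_by_def)

lemma (in group) normal_closure_minimal: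
  assumes "N \<lhd> G" "X \<subseteq> N"
  shows "normal_closure G X \<subseteq> N"
  unfolding normal_closure_def
proof (rule generate_subgroup_incl)
  show "subgroup N G" using assms(1) by (simp add: normal_def)
  show "{conj_by G x y |x y. x \<in> X \<and> y \<in> carrier G} \<subseteq> N"
    using assms normal_conj_by by blast
qed

lemma (in group) normal_closure_mono:
  assumes "X \<subseteq> Y" "Y \<subseteq> carrier G"
  shows "normal_closure G X \<subseteq> normal_closure G Y"
  by (rule normal_closure_minimal[OF normal_closure_normal[OF assms(2)]])
    (use assms normal_closure_incl in blast)

lemma (in subgroup) list_prod_closed:
  assumes "set xs \<subseteq> H"
  shows "list_prod G xs \<in> H"
  using assms by (induction xs) (auto simp: list_prod_def)

lemma (in group_hom) list_prod_image:
  assumes "set xs \<subseteq> carrier G"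
  shows "h (list_prod G xs) = list_prod H (map h xs)"
  using assms
proof (induction xs)
  case (Cons x xs)
  then show ?case using G.list_prod_closed[of xs] by (simp add: list_prod_def)
qed (simp add: list_prod_def)

text \<open>Induction on \<open>w\<close>. With \<open>x\<close> the product of all letters of
  \<open>T\<close>, the first letter of \<open>G\<close> passes through it by
  \<open>g x = x (g^x)\<close>. The remaining factors involve only letters of the shorter word, so
  the induction hypothesis supplies them. Keeping the target group and the two homomorphisms
  arbitrary lets the identity be read in both groups that are to be compared.\<close>

lemma collect_T_letters:
  assumes "group G" "group T" "group H" "f \<in> hom G H" "s \<in> hom T H"
    and "set w \<subseteq> carrier G \<times> carrier T"
  shows "list_prod H (map (\<lambda>(g, t). f g \<otimes>\<^bsub>H\<^esub> s t) w) =
    s (T_product T w) \<otimes>\<^bsub>H\<^esub> list_prod H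
      (map (\<lambda>i. conj_by H (f (fst (w ! i))) (s (tail_product T w i))) [0..<length w])"
  using assms(6)
proof (induction w)
  case Nil
  then show ?case
    using hom_one[OF assms(5,2,3)] group.is_monoid[OF assms(3)]
    by (simp add: T_product_def list_prod_def monoid.l_one)
next
  case (Cons a w)
  interpret T: group T by fact
  interpret H: group H by fact
  obtain g t where a: "a = (g, t)" "g \<in> carrier G" "t \<in> carrier T" using Cons.prems by auto
  have wT: "set (map snd v) \<subseteq> carrier T" if "set v \<subseteq> set w" for v :: "('a \<times> 'c) list"
    using that Cons.prems by auto
  have tp: "tail_product T w i \<in> carrier T" for i
    unfolding tail_product_def T_product_def by (intro T.list_prod_closed wT set_drop_subset)
  have T0: "T_product T w \<in> carrier T" using tp[of 0] by (simp add: tail_product_def)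
  have f: "f g \<in> carrier H" if "g \<in> carrier G" for g using that assms(4) by (auto simp: hom_def)
  have s: "s t \<in> carrier H" if "t \<in> carrier T" for t using that assms(5) by (auto simp: hom_def)
  let ?ps = "map (\<lambda>i. conj_by H (f (fst (w ! i))) (s (tail_product T w i))) [0..<length w]"
  have "set ?ps \<subseteq> carrier H"
  proof
    fix z assume "z \<in> set ?ps"
    then obtain i where i: "i < length w" "z = conj_by H (f (fst (w ! i))) (s (tail_product T w i))"
      by auto
    moreover have "fst (w ! i) \<in> carrier G" using nth_mem[OF i(1)] Cons.prems by auto
    ultimately show "z \<in> carrier H" using f s tp by simp
  qed
  then have p: "list_prod H ?ps \<in> carrier H" by (rule H.list_prod_closed)
  have Ta: "T_product T (a # w) = t \<otimes>\<^bsub>T\<^esub> T_product T w"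
    using a by (simp add: T_product_def list_prod_def)
  have sm: "s (t \<otimes>\<^bsub>T\<^esub> T_product T w) = s t \<otimes>\<^bsub>H\<^esub> s (T_product T w)"
    using assms(5) a(3) T0 by (simp add: hom_mult)
  \<comment> \<open>Index 0 gives the new factor, conjugated by the whole product of the letters of
    \<open>T\<close>. Index \<open>Suc i\<close> of \<open>a # w\<close> gives the factor with index
    \<open>i\<close> of \<open>w\<close>, since dropping \<open>Suc i\<close> entries removes
    \<open>a\<close> first.\<close>
  have "map (\<lambda>i. conj_by H (f (fst ((a # w) ! i))) (s (tail_product T (a # w) i))) [0..<length (a # w)]
      = conj_by H (f g) (s (T_product T (a # w))) # ?ps"
    unfolding length_Cons upt_conv_Cons[OF zero_less_Suc] map_Suc_upt[symmetric]
    using a by (simp add: tail_product_def comp_def)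
  moreover have "list_prod H (map (\<lambda>(g, t). f g \<otimes>\<^bsub>H\<^esub> s t) (a # w))
      = f g \<otimes>\<^bsub>H\<^esub> s t \<otimes>\<^bsub>H\<^esub> (s (T_product T w) \<otimes>\<^bsub>H\<^esub> list_prod H ?ps)"
    using Cons a by (simp add: list_prod_def)
  moreover have "\<dots> = s (T_product T (a # w)) \<otimes>\<^bsub>H\<^esub>
      (conj_by H (f g) (s (T_product T (a # w))) \<otimes>\<^bsub>H\<^esub> list_prod H ?ps)"
    using f[OF a(2)] s[OF a(3)] s[OF T0] p
    by (simp add: Ta sm conj_by_def H.m_assoc H.mult_inv_cancel)
  ultimately show ?case by (simp add: list_prod_def)
qed

section \<open>Relations and universal property of the amalgamated semidirect product\<close>

context amalgam_data
begin

abbreviation "amalgam \<equiv> amalgamated_semidirect A B \<phi> N \<psi>"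
abbreviation "inl \<equiv> amalgam_inl A B \<phi> N \<psi>"
abbreviation "inr \<equiv> amalgam_inr A B \<phi> N \<psi>"

lemma amalgam_proj_hom:
  "group_hom (semidirect A B \<phi>) amalgam (\<lambda>u. amalgam_kernel B N \<psi> #>\<^bsub>semidirect A B \<phi>\<^esub> u)"
  using normal.r_coset_hom_Mod[OF amalgam_kernel_normal] group_semidirect group_amalgamated
  by (simp add: group_hom_def group_hom_axioms_def amalgamated_semidirect_def)

lemma amalgam_inl_hom: "inl \<in> hom A amalgam"
proof -
  have "(\<lambda>a. (a, \<one>\<^bsub>B\<^esub>)) \<in> hom A (semidirect A B \<phi>)"
    by (auto simp: hom_def semidirect_def \<phi>_Bone)
  from hom_compose[OF this group_hom.homh[OF amalgam_proj_hom]]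
  show ?thesis by (simp add: amalgam_inl_def[abs_def] comp_def)
qed

lemma amalgam_inr_hom: "inr \<in> hom B amalgam"
proof -
  have "(\<lambda>b. (\<one>\<^bsub>A\<^esub>, b)) \<in> hom B (semidirect A B \<phi>)"
    by (auto simp: hom_def semidirect_def \<phi>_one)
  from hom_compose[OF this group_hom.homh[OF amalgam_proj_hom]]
  show ?thesis by (simp add: amalgam_inr_def[abs_def] comp_def)
qed

lemma amalgam_inl_inr:
  assumes "a \<in> carrier A" "b \<in> carrier B"
  shows "inl a \<otimes>\<^bsub>amalgam\<^esub> inr b = amalgam_kernel B N \<psi> #>\<^bsub>semidirect A B \<phi>\<^esub> (a, b)"
proof -
  interpret p: group_hom "semidirect A B \<phi>" amalgam
    "\<lambda>u. amalgam_kernel B N \<psi> #>\<^bsub>semidirect A B \<phi>\<^esub> u"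
    by (rule amalgam_proj_hom)
  show ?thesis
    using p.hom_mult[of "(a, \<one>\<^bsub>B\<^esub>)" "(\<one>\<^bsub>A\<^esub>, b)"] assms
    by (simp add: amalgam_inl_def amalgam_inr_def semidirect_def \<phi>_one)
qed

lemma amalgam_elements:
  assumes "x \<in> carrier amalgam"
  obtains a b where "a \<in> carrier A" "b \<in> carrier B" "x = inl a \<otimes>\<^bsub>amalgam\<^esub> inr b"
proof -
  from assms obtain u where "u \<in> carrier (semidirect A B \<phi>)"
    "x = amalgam_kernel B N \<psi> #>\<^bsub>semidirect A B \<phi>\<^esub> u"
    by (auto simp: amalgamated_semidirect_def FactGroup_def RCOSETS_def)
  then show ?thesis
    using that amalgam_inl_inr by (cases u) (auto simp: semidirect_def)
qed

text \<open>This is the multiplication rule of the semidirect product: a letter of \<open>B\<close>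
  passes to the right of a letter \<open>a\<close> of \<open>A\<close> at the cost of applying
  \<open>\<phi> a\<close>.\<close>

lemma amalgam_conj:
  assumes "a \<in> carrier A" "b \<in> carrier B"
  shows "conj_by amalgam (inr b) (inl a) = inr (\<phi> a b)"
proof -
  interpret p: group_hom "semidirect A B \<phi>" amalgam
    "\<lambda>u. amalgam_kernel B N \<psi> #>\<^bsub>semidirect A B \<phi>\<^esub> u"
    by (rule amalgam_proj_hom)
  \<comment> \<open>Both sides are the class of the pair \<open>(a, \<phi> a b)\<close>.\<close>
  have "inr b \<otimes>\<^bsub>amalgam\<^esub> inl a = inl a \<otimes>\<^bsub>amalgam\<^esub> inr (\<phi> a b)"
    using p.hom_mult[of "(\<one>\<^bsub>A\<^esub>, b)" "(a, \<one>\<^bsub>B\<^esub>)"] assms amalgam_inl_inr[of a "\<phi> a b"]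
    by (simp add: amalgam_inl_def amalgam_inr_def semidirect_def)
  moreover have "inl a \<in> carrier amalgam" "inr b \<in> carrier amalgam" "inr (\<phi> a b) \<in> carrier amalgam"
    using assms amalgam_inl_hom amalgam_inr_hom by (auto simp: hom_def)
  ultimately show ?thesis
    by (simp add: conj_by_def p.H.m_assoc p.H.mult_inv_cancel)
qed

text \<open>The quotient of the two elements is the class of \<open>n\<close> times the inverse of
  \<open>\<psi> n\<close>, which belongs to the subgroup factored out.\<close>

lemma amalgam_identify:
  assumes "n \<in> N"
  shows "inl n = inr (\<psi> n)"
proof -
  let ?P = "semidirect A B \<phi>"
  interpret p: group_hom ?P amalgam "\<lambda>u. amalgam_kernel B N \<psi> #>\<^bsub>?P\<^esub> u"
    by (rule amalgam_proj_hom)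
  have n: "n \<in> carrier A" using assms N.subset by blast
  have "inl n \<otimes>\<^bsub>amalgam\<^esub> inr (inv\<^bsub>B\<^esub> (\<psi> n)) = amalgam_kernel B N \<psi> #>\<^bsub>?P\<^esub> (n, inv\<^bsub>B\<^esub> (\<psi> n))"
    using assms n by (simp add: amalgam_inl_inr)
  also have "\<dots> = amalgam_kernel B N \<psi>"
    using assms n amalgam_kernel_normal
    by (intro p.G.coset_join2) (auto simp: normal_def amalgam_kernel_def semidirect_def)
  also have "\<dots> = \<one>\<^bsub>amalgam\<^esub>" by (simp add: amalgamated_semidirect_def)
  finally have "inl n \<otimes>\<^bsub>amalgam\<^esub> inr (inv\<^bsub>B\<^esub> (\<psi> n)) = \<one>\<^bsub>amalgam\<^esub>" .
  moreover interpret i: group_hom B amalgam inr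
    using amalgam_inr_hom group_amalgamated by (simp add: group_hom_def group_hom_axioms_def)
  have "inr (inv\<^bsub>B\<^esub> (\<psi> n)) = inv\<^bsub>amalgam\<^esub> (inr (\<psi> n))" using assms by simp
  moreover have "inl n \<in> carrier amalgam" "inr (\<psi> n) \<in> carrier amalgam"
    using n assms amalgam_inl_hom by (auto simp: hom_def)
  ultimately show ?thesis using p.H.inv_equality p.H.inv_inv p.H.inv_closed by metis
qed

text \<open>The only possible map sends the pair \<open>(a, b)\<close> to \<open>f a\<close> times
  \<open>g b\<close>. Assumption \<open>conj\<close> makes it multiplicative on the semidirect
  product, and \<open>ident\<close> makes it trivial on the amalgamation kernel, so it
  descends.\<close>

lemma amalgam_universal:
  assumes "group H" "f \<in> hom A H" "g \<in> hom B H"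
    and conj: "\<And>a b. a \<in> carrier A \<Longrightarrow> b \<in> carrier B \<Longrightarrow> g (\<phi> a b) = conj_by H (g b) (f a)"
    and ident: "\<And>n. n \<in> N \<Longrightarrow> f n = g (\<psi> n)"
  shows "\<exists>h\<in>hom amalgam H. (\<forall>a\<in>carrier A. h (inl a) = f a) \<and> (\<forall>b\<in>carrier B. h (inr b) = g b)"
proof -
  let ?P = "semidirect A B \<phi>"
  interpret f: group_hom A H f
    using assms(1,2) by (simp add: group_hom_def group_hom_axioms_def)
  interpret g: group_hom B H g
    using assms(1,3) by (simp add: group_hom_def group_hom_axioms_def)
  let ?k = "\<lambda>(a, b). f a \<otimes>\<^bsub>H\<^esub> g b"
  have "?k \<in> hom ?P H"
    by (rule homI) (auto simp: semidirect_def conj conj_by_def f.H.m_assoc f.H.mult_inv_cancel)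
  then interpret k: group_hom ?P H ?k
    using group_semidirect assms(1) by (simp add: group_hom_def group_hom_axioms_def)
  have "amalgam_kernel B N \<psi> \<subseteq> kernel ?P H ?k"
    using N.subset by (auto simp: amalgam_kernel_def kernel_def semidirect_def ident)
  from k.FactGroup_universal_kernel[OF amalgam_kernel_normal this]
  obtain h where h: "h \<in> hom amalgam H"
    "\<And>u. u \<in> carrier ?P \<Longrightarrow> h (amalgam_kernel B N \<psi> #>\<^bsub>?P\<^esub> u) = ?k u"
    unfolding amalgamated_semidirect_def by blast
  show ?thesis
  proof (intro bexI[OF _ h(1)] conjI ballI)
    show "h (inl a) = f a" if "a \<in> carrier A" for a
      using h(2)[of "(a, \<one>\<^bsub>B\<^esub>)"] that by (simp add: semidirect_def amalgam_inl_def)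
    show "h (inr b) = g b" if "b \<in> carrier B" for b
      using h(2)[of "(\<one>\<^bsub>A\<^esub>, b)"] that by (simp add: semidirect_def amalgam_inr_def)
  qed
qed

end

section \<open>The one-relator quotient of \<open>G * T\<close> by generators and relations\<close>

locale relative_presentation =
  fixes G :: "('g, 'm) monoid_scheme" and T :: "('t, 'n) monoid_scheme" and w :: "('g \<times> 't) list"
  assumes group_G: "group G" and group_T: "group T" and w: "set w \<subseteq> carrier G \<times> carrier T"
begin

abbreviation "F \<equiv> free_product G T"
abbreviation "Q \<equiv> Ghat G T w"

sublocale F: group F
  by (rule group_free_product[OF group_G group_T])

lemma free_inl_closed [simp, intro]: "g \<in> carrier G \<Longrightarrow> free_inl G T g \<in> carrier F"
  using free_inl_hom[OF group_G, of T] by (auto simp: hom_def)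

lemma free_inr_closed [simp, intro]: "x \<in> carrier T \<Longrightarrow> free_inr G T x \<in> carrier F"
  using free_inr_hom[OF group_T, of G] by (auto simp: hom_def)

lemma relative_word_letters:
  "set (map (\<lambda>(g, t). free_inl G T g \<otimes>\<^bsub>F\<^esub> free_inr G T t) w) \<subseteq> carrier F"
  using w by auto

lemma relative_word_closed: "relative_word G T w \<in> carrier F"
  unfolding relative_word_def by (rule F.list_prod_closed[OF relative_word_letters])

lemma kernel_normal: "one_relator_kernel G T w \<lhd> F"
  unfolding one_relator_kernel_def using relative_word_closed by (intro F.normal_closure_normal) simp

sublocale Q: group Q
  unfolding Ghat_def by (rule normal.factorgroup_is_group[OF kernel_normal])

lemma Q_proj_hom: "group_hom F Q (\<lambda>u. one_relator_kernel G T w #>\<^bsub>F\<^esub> u)"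
  using normal.r_coset_hom_Mod[OF kernel_normal] F.is_group Q.is_group
  by (simp add: group_hom_def group_hom_axioms_def Ghat_def)

lemma Ghat_G_hom: "Ghat_G G T w \<in> hom G Q"
  using hom_compose[OF free_inl_hom[OF group_G] group_hom.homh[OF Q_proj_hom]]
  by (simp add: Ghat_G_def[abs_def] comp_def)

lemma Ghat_T_hom: "Ghat_T G T w \<in> hom T Q"
  using hom_compose[OF free_inr_hom[OF group_T] group_hom.homh[OF Q_proj_hom]]
  by (simp add: Ghat_T_def[abs_def] comp_def)

lemma Ghat_G_closed [simp, intro]: "g \<in> carrier G \<Longrightarrow> Ghat_G G T w g \<in> carrier Q"
  using Ghat_G_hom by (auto simp: hom_def)

lemma Ghat_T_closed [simp, intro]: "x \<in> carrier T \<Longrightarrow> Ghat_T G T w x \<in> carrier Q"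
  using Ghat_T_hom by (auto simp: hom_def)

text \<open>The product is the coset of \<open>relative_word G T w\<close>, which lies in its own
  normal closure.\<close>

lemma Ghat_relation:
  "list_prod Q (map (\<lambda>(g, t). Ghat_G G T w g \<otimes>\<^bsub>Q\<^esub> Ghat_T G T w t) w) = \<one>\<^bsub>Q\<^esub>"
proof -
  interpret p: group_hom F Q "\<lambda>u. one_relator_kernel G T w #>\<^bsub>F\<^esub> u" by (rule Q_proj_hom)
  have "one_relator_kernel G T w #>\<^bsub>F\<^esub> relative_word G T w = one_relator_kernel G T w"
    using kernel_normal F.normal_closure_incl[of "{relative_word G T w}"] relative_word_closed
    by (intro F.coset_join2) (auto simp: normal_def one_relator_kernel_def)
  then have "one_relator_kernel G T w #>\<^bsub>F\<^esub> relative_word G T w = \<one>\<^bsub>Q\<^esub>"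
    by (simp add: Ghat_def)
  moreover have "one_relator_kernel G T w #>\<^bsub>F\<^esub> (case a of (g, t) \<Rightarrow> free_inl G T g \<otimes>\<^bsub>F\<^esub> free_inr G T t)
      = (case a of (g, t) \<Rightarrow> Ghat_G G T w g \<otimes>\<^bsub>Q\<^esub> Ghat_T G T w t)" if "a \<in> set w" for a
  proof -
    have "fst a \<in> carrier G" "snd a \<in> carrier T" using that w by auto
    then show ?thesis using p.hom_mult by (auto simp: Ghat_G_def Ghat_T_def split: prod.split)
  qed
  ultimately show ?thesis
    using p.list_prod_image[OF relative_word_letters]
    by (simp add: relative_word_def comp_def cong: map_cong)
qed

text \<open>The pair \<open>f\<close>, \<open>s\<close> extends to the free product. By
  \<open>rel\<close> the extension kills the relative word, so its kernel, being normal, contains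
  the whole normal closure and the map descends.\<close>

lemma Ghat_universal:
  assumes "group H" "f \<in> hom G H" "s \<in> hom T H"
    and rel: "list_prod H (map (\<lambda>(g, t). f g \<otimes>\<^bsub>H\<^esub> s t) w) = \<one>\<^bsub>H\<^esub>"
  obtains h where "h \<in> hom Q H" "\<And>g. g \<in> carrier G \<Longrightarrow> h (Ghat_G G T w g) = f g"
    "\<And>x. x \<in> carrier T \<Longrightarrow> h (Ghat_T G T w x) = s x"
proof -
  note fp = lift_free_product[OF group_G group_T assms(1-3)]
  let ?k = "lift H (case_sum f s)"
  interpret k: group_hom F H ?k
    using fp(1) assms(1) F.is_group by (simp add: group_hom_def group_hom_axioms_def)
  have "?k (case a of (g, t) \<Rightarrow> free_inl G T g \<otimes>\<^bsub>F\<^esub> free_inr G T t)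
      = (case a of (g, t) \<Rightarrow> f g \<otimes>\<^bsub>H\<^esub> s t)" if "a \<in> set w" for a
    using that w fp(2,3) by (auto split: prod.split)
  then have "?k (relative_word G T w) = \<one>\<^bsub>H\<^esub>"
    unfolding relative_word_def k.list_prod_image[OF relative_word_letters] rel[symmetric]
    by (simp add: comp_def cong: map_cong)
  then have "one_relator_kernel G T w \<subseteq> kernel F H ?k"
    unfolding one_relator_kernel_def using relative_word_closed
    by (intro F.normal_closure_minimal k.normal_kernel) (simp add: kernel_def)
  from k.FactGroup_universal_kernel[OF kernel_normal this]
  obtain h where h: "h \<in> hom Q H"
    "\<And>u. u \<in> carrier F \<Longrightarrow> h (one_relator_kernel G T w #>\<^bsub>F\<^esub> u) = ?k u"
    unfolding Ghat_def by blast
  show ?thesis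
  proof
    show "h \<in> hom Q H" by (rule h)
    show "h (Ghat_G G T w g) = f g" if "g \<in> carrier G" for g
      using h(2)[OF free_inl_closed[OF that]] fp(2)[OF that] by (simp add: Ghat_G_def)
    show "h (Ghat_T G T w x) = s x" if "x \<in> carrier T" for x
      using h(2)[OF free_inr_closed[OF that]] fp(3)[OF that] by (simp add: Ghat_T_def)
  qed
qed

text \<open>The preimage of \<open>H\<close> in the free product is a subgroup containing both
  factors, hence everything. This reduces surjectivity onto the quotient to the images of
  \<open>G\<close> and \<open>T\<close>.\<close>

lemma Ghat_generators:
  assumes "subgroup H Q" "\<And>g. g \<in> carrier G \<Longrightarrow> Ghat_G G T w g \<in> H"
    "\<And>x. x \<in> carrier T \<Longrightarrow> Ghat_T G T w x \<in> H"
  shows "carrier Q \<subseteq> H"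
proof
  interpret p: group_hom F Q "\<lambda>u. one_relator_kernel G T w #>\<^bsub>F\<^esub> u" by (rule Q_proj_hom)
  interpret H: subgroup H Q by fact
  have "subgroup {u \<in> carrier F. one_relator_kernel G T w #>\<^bsub>F\<^esub> u \<in> H} F"
    by (rule F.subgroupI) auto
  then have "carrier F \<subseteq> {u \<in> carrier F. one_relator_kernel G T w #>\<^bsub>F\<^esub> u \<in> H}"
    by (rule free_product_generators[OF group_G group_T])
      (use assms(2,3) in \<open>auto simp: Ghat_G_def Ghat_T_def\<close>)
  moreover fix x assume "x \<in> carrier Q"
  then obtain u where "u \<in> carrier F" "x = one_relator_kernel G T w #>\<^bsub>F\<^esub> u"
    by (auto simp: Ghat_def FactGroup_def RCOSETS_def)
  ultimately show "x \<in> H" by blast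
qed

end

section \<open>The trivial coset and the universal property of \<open>L\<close>\<close>

context relative_setting
begin

text \<open>The copy of \<open>G\<close> with index \<open>R\<close> is the distinguished one: since
  the representative of \<open>R\<close> is 1, conjugation by it disappears.\<close>

lemma R_coset: "R \<in> cosets" and transversal_one: "c R = \<one>\<^bsub>T\<^esub>"
  using T.coset_mult_one[OF R.subset] transv
  by (auto simp: FactGroup_def RCOSETS_def transversal_def)

text \<open>\<open>L\<close> is a binary free product whose second factor is itself the free product
  of the copies of \<open>G\<close>, so the required map is a lift nested inside a lift.\<close>

lemma L_universal:
  assumes "group H" "f \<in> hom (T\<lparr>carrier := R\<rparr>) H" "\<And>y. y \<in> cosets \<Longrightarrow> k y \<in> hom G H"
  obtains h where "h \<in> hom L H" "\<And>r. r \<in> R \<Longrightarrow> h (bar r) = f r"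
    "\<And>y g. y \<in> cosets \<Longrightarrow> g \<in> carrier G \<Longrightarrow> h (copy y g) = k y g"
proof -
  let ?F = "free_product_family cosets (\<lambda>_. G)"
  have F: "group ?F" by (rule group_free_product_family[OF group_G])
  note fam = lift_free_product_family[where F = "\<lambda>_. G" and I = cosets and f = k, OF group_G assms(1,3)]
  note fp = lift_free_product[OF group_R F assms(1,2) fam(1)]
  have in_F: "free_in cosets (\<lambda>_. G) y g \<in> carrier ?F" if "y \<in> cosets" "g \<in> carrier G" for y g
    using free_in_hom[of y cosets "\<lambda>_. G"] group_G that by (auto simp: hom_def)
  show ?thesis
  proof
    let ?h = "lift H (case_sum f (lift H (case_prod k)))"
    show "?h \<in> hom L H" using fp(1) by (simp add: L_group_def)
    show "?h (bar r) = f r" if "r \<in> R" for r using fp(2)[of r] that by (simp add: L_bar_def)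
    show "?h (copy y g) = k y g" if "y \<in> cosets" "g \<in> carrier G" for y g
      using fp(3)[OF _ in_F[OF that]] fam(2)[OF _ that] by (simp add: L_copy_def group_G assms)
  qed
qed

end

section \<open>The homomorphisms between the amalgamated product and the one-relator
  quotient\<close>

locale relator_setting = relative_setting G T R c
  for G :: "('g, 'm) monoid_scheme" and T :: "('t, 'n) monoid_scheme"
    and R :: "'t set" and c :: "'t set \<Rightarrow> 't" +
  fixes w :: "('g \<times> 't) list"
  assumes letters: "set w \<subseteq> carrier G \<times> carrier T" and T_product_R: "T_product T w \<in> R"
begin

sublocale relative_presentation G T w
  by (rule relative_presentation.intro[OF group_G group_T letters])

abbreviation "ker \<equiv> K_kernel G T R c w"
abbreviation "Kg \<equiv> K_group G T R c w"
abbreviation "K_act \<equiv> K_action G T R c w"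
abbreviation "K_inR \<equiv> K_bar G T R c w"
abbreviation "K_inG \<equiv> K_copy G T R c w"
abbreviation "gG \<equiv> Ghat_G G T w"
abbreviation "gT \<equiv> Ghat_T G T w"

sublocale K: amalgam_data T Kg K_act R K_inR
  by (rule K_amalgam_data[OF letters T_product_R])

lemma K_proj_group_hom: "group_hom L Kg (\<lambda>u. ker #>\<^bsub>L\<^esub> u)"
  using K_proj_hom[OF letters T_product_R] group_L K.group_B
  by (simp add: group_hom_def group_hom_axioms_def)

lemma K_elements: "C \<in> carrier Kg \<Longrightarrow> \<exists>u\<in>carrier L. C = ker #>\<^bsub>L\<^esub> u"
  by (rule K_carrier[OF letters T_product_R])

lemma inl_group_hom: "group_hom T K.amalgam K.inl"
  using K.amalgam_inl_hom group_T K.group_amalgamated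
  by (simp add: group_hom_def group_hom_axioms_def)

lemma inr_group_hom: "group_hom Kg K.amalgam K.inr"
  using K.amalgam_inr_hom K.group_B K.group_amalgamated
  by (simp add: group_hom_def group_hom_axioms_def)

lemma inr_proj_group_hom: "group_hom L K.amalgam (\<lambda>u. K.inr (ker #>\<^bsub>L\<^esub> u))"
  using hom_compose[OF group_hom.homh[OF K_proj_group_hom] K.amalgam_inr_hom]
    group_L K.group_amalgamated
  by (simp add: group_hom_def group_hom_axioms_def comp_def)

lemma gT_group_hom: "group_hom T Q gT"
  using Ghat_T_hom group_T Q.is_group by (simp add: group_hom_def group_hom_axioms_def)

text \<open>The relator lies in \<open>N1_sub\<close>, and the translate of \<open>N1_sub\<close>
  with index \<open>R\<close> is taken by the action of \<open>c R = 1\<close>, which fixes the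
  relator.\<close>

lemma relator_in_kernel: "L_relator G T R c w \<in> ker"
proof -
  let ?L1 = "L\<lparr>carrier := L1_sub G T R w\<rparr>" and ?r = "L_relator G T R c w"
  interpret L1: group ?L1
    using L1_subgroup[OF letters T_product_R] group_L by (rule subgroup.subgroup_is_group)
  have "?r \<in> N1_sub G T R c w"
    unfolding N1_sub_def
    using L1.normal_closure_incl[of "{?r}"] L_relator_L1[OF letters T_product_R] by simp
  moreover have "act (c R) ?r = ?r"
    using act_one[OF L_relator_closed[OF letters T_product_R]] by (simp add: transversal_one)
  ultimately have "?r \<in> N_sub G T R c w R"
    unfolding N_sub_def by (metis imageI)
  moreover have "(\<Union>y\<in>cosets. N_sub G T R c w y) \<subseteq> carrier L"
    using N_subset[OF letters T_product_R] by blast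
  ultimately show ?thesis
    using L.normal_closure_incl R_coset unfolding K_kernel_def by blast
qed

text \<open>Conjugation by \<open>x\<close> is the action of \<open>x\<close>, evaluated here on the
  copy with index \<open>R\<close>, where \<open>c R = 1\<close>. Thus conjugates of the
  distinguished copy of \<open>G\<close> by elements of \<open>T\<close> run through the other
  copies. Taking \<open>x\<close> to be a tail product gives the factors of the relator; taking
  \<open>x = c y\<close> gives the copy with index \<open>y\<close>.\<close>

lemma inr_copy_conj:
  assumes "g \<in> carrier G" "x \<in> carrier T"
  shows "conj_by K.amalgam (K.inr (K_inG R g)) (K.inl x) =
    K.inr (ker #>\<^bsub>L\<^esub> conj_by L (copy (R #>\<^bsub>T\<^esub> x) g) (bar (inv\<^bsub>T\<^esub> (c (R #>\<^bsub>T\<^esub> x)) \<otimes>\<^bsub>T\<^esub> x)))"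
proof -
  interpret p: group_hom L Kg "\<lambda>u. ker #>\<^bsub>L\<^esub> u" by (rule K_proj_group_hom)
  have g: "copy R g \<in> carrier L" using copy_closed[OF R_coset assms(1)] .
  have "c (R #>\<^bsub>T\<^esub> x) \<in> carrier T"
    using coset_act(2)[OF coset_act(1)[OF R_coset assms(2)] assms(2)] .
  then show ?thesis
    using K.amalgam_conj[OF assms(2) p.hom_closed[OF g]] assms
      K_action_coset[OF letters T_product_R assms(2) g] L_action_generators(3)[OF assms(2) R_coset assms(1)]
    by (simp add: K_copy_def transversal_one)
qed

text \<open>By the universal property of the quotient it suffices that the image of \<open>w\<close>
  is trivial. Collecting the letters of \<open>T\<close> turns this image into the class of
  \<open>L_relator\<close>, which vanishes in \<open>K\<close>.\<close>

lemma Ghat_to_amalgam: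
  obtains h where "h \<in> hom Q K.amalgam" "\<And>g. g \<in> carrier G \<Longrightarrow> h (gG g) = K.inr (K_inG R g)"
    "\<And>x. x \<in> carrier T \<Longrightarrow> h (gT x) = K.inl x"
proof -
  interpret j: group_hom L K.amalgam "\<lambda>u. K.inr (ker #>\<^bsub>L\<^esub> u)" by (rule inr_proj_group_hom)
  have G_hom: "(\<lambda>g. K.inr (K_inG R g)) \<in> hom G K.amalgam"
    using hom_compose[OF copy_hom[OF R_coset] j.homh] by (simp add: K_copy_def[abs_def] comp_def)
  let ?z = "\<lambda>i. conj_by L (copy (tail_coset T R w i) (fst (w ! i))) (bar (tail_rem T R c w i))"
  have g: "fst (w ! i) \<in> carrier G" if "i < length w" for i
    using nth_mem[OF that] letters by auto
  have z: "?z i \<in> carrier L" if "i < length w" for i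
    using g[OF that] tail_coset_closed[OF letters T_product_R] tail_rem_closed[OF letters T_product_R]
    by blast
  \<comment> \<open>For \<open>x\<close> the tail product, the coset \<open>R x\<close> is
    \<open>tail_coset\<close> and the conjugating element of \<open>R\<close> is
    \<open>tail_rem\<close> by definition.\<close>
  have "conj_by K.amalgam (K.inr (K_inG R (fst (w ! i)))) (K.inl (tail_product T w i))
      = K.inr (ker #>\<^bsub>L\<^esub> ?z i)" if "i < length w" for i
    using inr_copy_conj[OF g[OF that] tail_product_closed[OF letters T_product_R, of i]]
    by (simp add: tail_coset_def tail_rem_def)
  then have "map (\<lambda>i. conj_by K.amalgam (K.inr (K_inG R (fst (w ! i)))) (K.inl (tail_product T w i)))
      [0..<length w] = map (\<lambda>u. K.inr (ker #>\<^bsub>L\<^esub> u)) (map ?z [0..<length w])"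
    by simp
  moreover have zs: "set (map ?z [0..<length w]) \<subseteq> carrier L" using z by auto
  \<comment> \<open>The leading factor lies in \<open>R\<close>, where the embeddings of
    \<open>T\<close> and \<open>K\<close> agree, so the whole product can be read inside
    \<open>K\<close>.\<close>
  moreover have "K.inl (T_product T w) = K.inr (ker #>\<^bsub>L\<^esub> bar (T_product T w))"
    using K.amalgam_identify[OF T_product_R] by (simp add: K_bar_def)
  ultimately have "list_prod K.amalgam (map (\<lambda>(g, t). K.inr (K_inG R g) \<otimes>\<^bsub>K.amalgam\<^esub> K.inl t) w)
      = K.inr (ker #>\<^bsub>L\<^esub> L_relator G T R c w)"
    using collect_T_letters[OF group_G group_T j.H.is_group G_hom K.amalgam_inl_hom letters]
      j.list_prod_image[OF zs] j.hom_mult[OF bar_closed[OF T_product_R] L.list_prod_closed[OF zs]]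
    by (simp only: L_relator_def)
  also have "ker #>\<^bsub>L\<^esub> L_relator G T R c w = \<one>\<^bsub>Kg\<^esub>"
    using relator_in_kernel K_kernel_normal[OF letters T_product_R] L_relator_closed[OF letters T_product_R]
      L.coset_join2[of "L_relator G T R c w" ker]
    by (simp add: K_group_def normal_def)
  also have "K.inr \<dots> = \<one>\<^bsub>K.amalgam\<^esub>" by (rule group_hom.hom_one[OF inr_group_hom])
  finally show ?thesis
    using Ghat_universal[OF j.H.is_group G_hom K.amalgam_inl_hom] that by blast
qed

text \<open>Both sides are homomorphisms in \<open>u\<close>, so generators suffice. On the copy
  with index \<open>y\<close>, the action produces the copy with index \<open>yx\<close> conjugated
  by the element \<open>a\<close> with \<open>c_(yx) a = c_y x\<close>; both sides are then the
  conjugate of \<open>g\<close> by \<open>c_y x\<close>.\<close>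

lemma L_to_Ghat_equivariant:
  assumes h: "h \<in> hom L Q" "\<And>r. r \<in> R \<Longrightarrow> h (bar r) = gT r"
    "\<And>y g. y \<in> cosets \<Longrightarrow> g \<in> carrier G \<Longrightarrow> h (copy y g) = conj_by Q (gG g) (gT (c y))"
    and x: "x \<in> carrier T" and u: "u \<in> carrier L"
  shows "h (act x u) = conj_by Q (h u) (gT x)"
proof -
  interpret s: group_hom T Q gT by (rule gT_group_hom)
  interpret h: group_hom L Q h using h(1) by (simp add: group_hom_def group_hom_axioms_def)
  have "(h \<circ> act x) u = ((\<lambda>z. conj_by Q z (gT x)) \<circ> h) u"
  proof (rule L_hom_eqI[OF _ _ Q.is_group u])
    show "h \<circ> act x \<in> hom L Q" by (rule hom_compose[OF L_action_generators(1)[OF x] h(1)])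
    show "(\<lambda>z. conj_by Q z (gT x)) \<circ> h \<in> hom L Q"
      using hom_compose[OF h(1) Q.conj_by_hom] x by blast
  next
    fix r assume "r \<in> R"
    then show "(h \<circ> act x) (bar r) = ((\<lambda>z. conj_by Q z (gT x)) \<circ> h) (bar r)"
      using x conj_R s.conj_by_image[of r x] R.subset by (simp add: L_action_generators(2) h(2))
  next
    fix y g assume y: "y \<in> cosets" and g: "g \<in> carrier G"
    let ?z = "y #>\<^bsub>T\<^esub> x" and ?a = "inv\<^bsub>T\<^esub> (c (y #>\<^bsub>T\<^esub> x)) \<otimes>\<^bsub>T\<^esub> c y \<otimes>\<^bsub>T\<^esub> x"
    have z: "?z \<in> cosets" and a: "?a \<in> R" and cy: "c y \<in> carrier T" using coset_act[OF y x] by auto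
    have cz: "c ?z \<in> carrier T" using coset_act(2)[OF z x] .
    have aT: "?a \<in> carrier T" using a R.subset by blast
    have e: "c ?z \<otimes>\<^bsub>T\<^esub> ?a = c y \<otimes>\<^bsub>T\<^esub> x" using cz cy x by (simp add: T.m_assoc T.mult_inv_cancel)
    have "h (act x (copy y g)) = conj_by Q (conj_by Q (gG g) (gT (c ?z))) (gT ?a)"
      using L_action_generators(3)[OF x y g] h.conj_by_image[OF copy_closed[OF z g] bar_closed[OF a]]
        h(2)[OF a] h(3)[OF z g] by simp
    also have "\<dots> = conj_by Q (gG g) (gT (c y \<otimes>\<^bsub>T\<^esub> x))"
      using Q.conj_by_conj_by[of "gG g" "gT (c ?z)" "gT ?a"] g cz aT s.hom_mult[OF cz aT] e by simp
    also have "\<dots> = conj_by Q (h (copy y g)) (gT x)"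
      using Q.conj_by_conj_by[of "gG g" "gT (c y)" "gT x"] g cy x h(3)[OF y g] by simp
    finally show "(h \<circ> act x) (copy y g) = ((\<lambda>z. conj_by Q z (gT x)) \<circ> h) (copy y g)" by simp
  qed
  then show ?thesis by simp
qed

text \<open>Since \<open>tail_rem\<close> is what multiplies the coset representative to the tail
  product, each factor of the relator becomes a conjugate of a letter of \<open>G\<close> by a tail
  product. Reading \<open>collect_T_letters\<close> backwards reassembles \<open>w\<close>, which is
  trivial in the quotient.\<close>

lemma L_to_Ghat_relator:
  assumes h: "h \<in> hom L Q" "\<And>r. r \<in> R \<Longrightarrow> h (bar r) = gT r"
    "\<And>y g. y \<in> cosets \<Longrightarrow> g \<in> carrier G \<Longrightarrow> h (copy y g) = conj_by Q (gG g) (gT (c y))"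
  shows "h (L_relator G T R c w) = \<one>\<^bsub>Q\<^esub>"
proof -
  interpret s: group_hom T Q gT by (rule gT_group_hom)
  interpret h: group_hom L Q h using h(1) by (simp add: group_hom_def group_hom_axioms_def)
  let ?z = "\<lambda>i. conj_by L (copy (tail_coset T R w i) (fst (w ! i))) (bar (tail_rem T R c w i))"
  note y = tail_coset_closed[OF letters T_product_R] and r = tail_rem_closed[OF letters T_product_R]
    and tp = tail_product_closed[OF letters T_product_R]
  have g: "fst (w ! i) \<in> carrier G" if "i < length w" for i
    using nth_mem[OF that] letters by auto
  have zs: "set (map ?z [0..<length w]) \<subseteq> carrier L" using g y r by auto
  have "h (?z i) = conj_by Q (gG (fst (w ! i))) (gT (tail_product T w i))" if i: "i < length w" for i
  proof -
    have cy: "c (tail_coset T R w i) \<in> carrier T" by (rule coset_act(2)[OF y tp])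
    have rT: "tail_rem T R c w i \<in> carrier T" using r R.subset by blast
    have e: "c (tail_coset T R w i) \<otimes>\<^bsub>T\<^esub> tail_rem T R c w i = tail_product T w i"
      using cy tp by (simp add: tail_rem_def T.mult_inv_cancel)
    have "h (?z i) = conj_by Q (conj_by Q (gG (fst (w ! i))) (gT (c (tail_coset T R w i)))) (gT (tail_rem T R c w i))"
      using h.conj_by_image[OF copy_closed[OF y g[OF i]] bar_closed[OF r]] h(2)[OF r] h(3)[OF y g[OF i]]
      by simp
    then show ?thesis
      using Q.conj_by_conj_by[OF Ghat_G_closed[OF g[OF i]] Ghat_T_closed[OF cy] Ghat_T_closed[OF rT]]
        s.hom_mult[OF cy rT] e by simp
  qed
  then have "map h (map ?z [0..<length w])
      = map (\<lambda>i. conj_by Q (gG (fst (w ! i))) (gT (tail_product T w i))) [0..<length w]" by simp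
  then have "h (L_relator G T R c w) = list_prod Q (map (\<lambda>(g, t). gG g \<otimes>\<^bsub>Q\<^esub> gT t) w)"
    unfolding L_relator_def h.hom_mult[OF bar_closed[OF T_product_R] L.list_prod_closed[OF zs]]
      h.list_prod_image[OF zs] collect_T_letters[OF group_G group_T Q.is_group Ghat_G_hom Ghat_T_hom letters]
      h(2)[OF T_product_R] by (simp only:)
  then show ?thesis by (simp only: Ghat_relation)
qed

text \<open>The map on \<open>L\<close> kills the relator, hence \<open>N1_sub\<close>, hence by
  equivariance all its translates, hence \<open>K_kernel\<close>. The induced map on
  \<open>K\<close> inherits equivariance, which is the compatibility needed to extend it to the
  amalgamated product.\<close>

lemma K_to_Ghat:
  obtains k where "k \<in> hom Kg Q" "\<And>r. r \<in> R \<Longrightarrow> k (K_inR r) = gT r"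
    "\<And>y g. y \<in> cosets \<Longrightarrow> g \<in> carrier G \<Longrightarrow> k (K_inG y g) = conj_by Q (gG g) (gT (c y))"
    "\<And>x C. x \<in> carrier T \<Longrightarrow> C \<in> carrier Kg \<Longrightarrow> k (K_act x C) = conj_by Q (k C) (gT x)"
proof -
  have "gT \<in> hom (T\<lparr>carrier := R\<rparr>) Q"
    using Ghat_T_hom R.subset by (auto simp: hom_def)
  moreover have "(\<lambda>g. conj_by Q (gG g) (gT (c y))) \<in> hom G Q" if "y \<in> cosets" for y
    using hom_compose[OF Ghat_G_hom Q.conj_by_hom[of "gT (c y)"]] coset_act(2)[OF that T.one_closed]
    by (simp add: comp_def)
  ultimately obtain h where h: "h \<in> hom L Q" "\<And>r. r \<in> R \<Longrightarrow> h (bar r) = gT r"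
    "\<And>y g. y \<in> cosets \<Longrightarrow> g \<in> carrier G \<Longrightarrow> h (copy y g) = conj_by Q (gG g) (gT (c y))"
    by (rule L_universal[OF Q.is_group]) blast+
  note equi = L_to_Ghat_equivariant[OF h]
  interpret h: group_hom L Q h using h(1) by (simp add: group_hom_def group_hom_axioms_def)
  \<comment> \<open>\<open>N1_sub\<close> is a normal closure inside the subgroup
    \<open>L1_sub\<close>, so minimality is applied to the restriction of \<open>h\<close> to that
    subgroup.\<close>
  let ?L1 = "L\<lparr>carrier := L1_sub G T R w\<rparr>"
  note sub1 = L1_subgroup[OF letters T_product_R]
  have "h \<in> hom ?L1 Q"
    by (rule homI) (use subgroup.subset[OF sub1] in \<open>simp_all add: subsetD\<close>)
  then interpret h1: group_hom ?L1 Q h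
    using subgroup.subgroup_is_group[OF sub1 group_L]
    by (simp add: group_hom_def group_hom_axioms_def)
  have "N1_sub G T R c w \<subseteq> kernel ?L1 Q h"
    unfolding N1_sub_def
    using L_to_Ghat_relator[OF h] L_relator_L1[OF letters T_product_R]
    by (intro h1.normal_closure_minimal h1.normal_kernel) (simp add: kernel_def)
  then have "h n = \<one>\<^bsub>Q\<^esub>" if "n \<in> N1_sub G T R c w" for n
    using that by (auto simp: kernel_def)
  moreover have "n \<in> carrier L" if "n \<in> N1_sub G T R c w" for n
    using that N1_subset[OF letters T_product_R] by blast
  \<comment> \<open>By equivariance the value on a translate is a conjugate of the value on
    \<open>n\<close>, which is 1.\<close>
  ultimately have "h (act (c y) n) = \<one>\<^bsub>Q\<^esub>" "act (c y) n \<in> carrier L"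
    if "n \<in> N1_sub G T R c w" "y \<in> cosets" for n y
    using that coset_act(2)[OF that(2) T.one_closed] equi by (simp_all add: conj_by_def)
  then have "ker \<subseteq> kernel L Q h"
    unfolding K_kernel_def
    by (intro L.normal_closure_minimal h.normal_kernel) (auto simp: kernel_def N_sub_def)
  from h.FactGroup_universal_kernel[OF K_kernel_normal[OF letters T_product_R] this]
  obtain k where k: "k \<in> hom Kg Q" "\<And>u. u \<in> carrier L \<Longrightarrow> k (ker #>\<^bsub>L\<^esub> u) = h u"
    unfolding K_group_def by blast
  show ?thesis
  proof
    show "k \<in> hom Kg Q" by (rule k)
    show "k (K_inR r) = gT r" if "r \<in> R" for r using that by (simp add: K_bar_def k h)
    show "k (K_inG y g) = conj_by Q (gG g) (gT (c y))" if "y \<in> cosets" "g \<in> carrier G" for y g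
      using that by (simp add: K_copy_def k h)
    fix x C assume x: "x \<in> carrier T" and "C \<in> carrier Kg"
    then obtain u where u: "u \<in> carrier L" "C = ker #>\<^bsub>L\<^esub> u" using K_elements by blast
    then show "k (K_act x C) = conj_by Q (k C) (gT x)"
      using x by (simp add: K_action_coset[OF letters T_product_R] k equi)
  qed
qed

text \<open>The map \<open>h\<close> glues the embedding of \<open>T\<close> with \<open>k\<close>.
  The map \<open>f\<close> in the other direction is a left inverse, which gives injectivity;
  surjectivity holds because the image of \<open>h\<close> contains the generators. The restriction
  \<open>k\<close> of \<open>h\<close> to \<open>K\<close> is returned as well, to compute the image
  of \<open>K\<close>.\<close>

lemma amalgam_iso_Ghat:
  obtains h k where "h \<in> iso K.amalgam Q" "k \<in> hom Kg Q"
    "\<And>x. x \<in> carrier T \<Longrightarrow> h (K.inl x) = gT x" "\<And>C. C \<in> carrier Kg \<Longrightarrow> h (K.inr C) = k C"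
    "\<And>r. r \<in> R \<Longrightarrow> k (K_inR r) = gT r"
    "\<And>y g. y \<in> cosets \<Longrightarrow> g \<in> carrier G \<Longrightarrow> k (K_inG y g) = conj_by Q (gG g) (gT (c y))"
proof -
  obtain k where k: "k \<in> hom Kg Q" "\<And>r. r \<in> R \<Longrightarrow> k (K_inR r) = gT r"
    "\<And>y g. y \<in> cosets \<Longrightarrow> g \<in> carrier G \<Longrightarrow> k (K_inG y g) = conj_by Q (gG g) (gT (c y))"
    "\<And>x C. x \<in> carrier T \<Longrightarrow> C \<in> carrier Kg \<Longrightarrow> k (K_act x C) = conj_by Q (k C) (gT x)"
    by (rule K_to_Ghat) blast
  have "\<exists>h\<in>hom K.amalgam Q. (\<forall>x\<in>carrier T. h (K.inl x) = gT x) \<and> (\<forall>C\<in>carrier Kg. h (K.inr C) = k C)"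
    by (rule K.amalgam_universal[OF Q.is_group Ghat_T_hom k(1)]) (simp_all add: k(2,4))
  then obtain h where h: "h \<in> hom K.amalgam Q" "\<And>x. x \<in> carrier T \<Longrightarrow> h (K.inl x) = gT x"
    "\<And>C. C \<in> carrier Kg \<Longrightarrow> h (K.inr C) = k C"
    by blast
  obtain f where f: "f \<in> hom Q K.amalgam" "\<And>g. g \<in> carrier G \<Longrightarrow> f (gG g) = K.inr (K_inG R g)"
    "\<And>x. x \<in> carrier T \<Longrightarrow> f (gT x) = K.inl x"
    by (rule Ghat_to_amalgam) blast
  interpret h: group_hom K.amalgam Q h
    using h(1) K.group_amalgamated by (simp add: group_hom_def group_hom_axioms_def)
  interpret f: group_hom Q K.amalgam f
    using f(1) K.group_amalgamated by (simp add: group_hom_def group_hom_axioms_def)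
  interpret k: group_hom Kg Q k
    using k(1) K.group_B by (simp add: group_hom_def group_hom_axioms_def)
  interpret p: group_hom L Kg "\<lambda>u. ker #>\<^bsub>L\<^esub> u" by (rule K_proj_group_hom)
  interpret i: group_hom T K.amalgam K.inl by (rule inl_group_hom)
  interpret j: group_hom Kg K.amalgam K.inr by (rule inr_group_hom)
  have KR: "K_inG R g \<in> carrier Kg" if "g \<in> carrier G" for g
    using that copy_closed[OF R_coset that] by (simp add: K_copy_def)
  \<comment> \<open>Composing with the projection from \<open>L\<close> reduces the equality to the
    generators of \<open>L\<close>.\<close>
  have fk: "f (k C) = K.inr C" if C: "C \<in> carrier Kg" for C
  proof -
    obtain u where u: "u \<in> carrier L" "C = ker #>\<^bsub>L\<^esub> u" using K_elements[OF C] by blast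
    have "(f \<circ> (k \<circ> (\<lambda>u. ker #>\<^bsub>L\<^esub> u))) u = (K.inr \<circ> (\<lambda>u. ker #>\<^bsub>L\<^esub> u)) u"
    proof (rule L_hom_eqI[OF _ _ K.group_amalgamated u(1)])
      show "f \<circ> (k \<circ> (\<lambda>u. ker #>\<^bsub>L\<^esub> u)) \<in> hom L K.amalgam"
        by (rule hom_compose[OF hom_compose[OF p.homh k(1)] f(1)])
      show "K.inr \<circ> (\<lambda>u. ker #>\<^bsub>L\<^esub> u) \<in> hom L K.amalgam"
        by (rule hom_compose[OF p.homh j.homh])
    next
      fix r assume "r \<in> R"
      then show "(f \<circ> (k \<circ> (\<lambda>u. ker #>\<^bsub>L\<^esub> u))) (bar r) = (K.inr \<circ> (\<lambda>u. ker #>\<^bsub>L\<^esub> u)) (bar r)"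
        using k(2)[of r] K.amalgam_identify[of r] f(3)[of r] R.subset by (auto simp: K_bar_def)
    next
      fix y g assume y: "y \<in> cosets" and g: "g \<in> carrier G"
      have cy: "c y \<in> carrier T" "R #>\<^bsub>T\<^esub> c y = y" using coset_act(2,3)[OF y T.one_closed] by auto
      have "f (k (K_inG y g)) = conj_by K.amalgam (K.inr (K_inG R g)) (K.inl (c y))"
        using k(3)[OF y g] f.conj_by_image[of "gG g" "gT (c y)"] f(2,3) g cy by simp
      \<comment> \<open>For \<open>x = c y\<close> the coset \<open>R x\<close> is \<open>y\<close>,
        so the remaining conjugating element is the inverse of \<open>c y\<close> times
        \<open>c y\<close>, that is 1.\<close>
      also have "\<dots> = K.inr (ker #>\<^bsub>L\<^esub> copy y g)"
        using inr_copy_conj[OF g cy(1)] cy copy_closed[OF y g] by (simp add: bar_one conj_by_def)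
      finally show "(f \<circ> (k \<circ> (\<lambda>u. ker #>\<^bsub>L\<^esub> u))) (copy y g) = (K.inr \<circ> (\<lambda>u. ker #>\<^bsub>L\<^esub> u)) (copy y g)"
        by (simp add: K_copy_def)
    qed
    then show ?thesis using u by simp
  qed
  have fh: "f (h z) = z" if z: "z \<in> carrier K.amalgam" for z
  proof -
    obtain x C where "x \<in> carrier T" "C \<in> carrier Kg" "z = K.inl x \<otimes>\<^bsub>K.amalgam\<^esub> K.inr C"
      using z by (rule K.amalgam_elements)
    then show ?thesis by (simp add: h fk f)
  qed
  \<comment> \<open>The copy with index \<open>R\<close> is mapped onto \<open>G\<close> without
    conjugation, because \<open>c R = 1\<close>.\<close>
  have "gG g \<in> h ` carrier K.amalgam" if g: "g \<in> carrier G" for g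
  proof -
    have "k (K_inG R g) = gG g"
      using k(3)[OF R_coset g] g group_hom.hom_one[OF gT_group_hom]
      by (simp add: transversal_one conj_by_def)
    then show ?thesis using h(3)[OF KR[OF g]] j.hom_closed[OF KR[OF g]] by (metis imageI)
  qed
  moreover have "gT x \<in> h ` carrier K.amalgam" if "x \<in> carrier T" for x
    using h(2)[OF that] i.hom_closed[OF that] by (metis imageI)
  ultimately have "carrier Q \<subseteq> h ` carrier K.amalgam"
    by (rule Ghat_generators[OF h.img_is_subgroup])
  then have "h ` carrier K.amalgam = carrier Q" by auto
  moreover have "inj_on h (carrier K.amalgam)" using fh by (rule inj_on_inverseI)
  ultimately have "h \<in> iso K.amalgam Q" using h(1) by (simp add: iso_def bij_betw_def)
  then show ?thesis using that[OF _ k(1) h(2,3) k(2,3)] by blast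
qed

text \<open>The relation \<open>w = 1\<close> expresses \<open>t\<close> as the inverse of a product
  of conjugates of letters of \<open>G\<close>. This is what later allows \<open>R\<close> to be
  replaced by \<open>S\<close>.\<close>

lemma relator_image_closure:
  assumes X: "gG ` carrier G \<subseteq> X" "X \<subseteq> carrier Q"
  shows "gT (T_product T w) \<in> normal_closure Q X"
proof -
  let ?N = "normal_closure Q X" and ?t = "gT (T_product T w)"
  let ?ps = "map (\<lambda>i. conj_by Q (gG (fst (w ! i))) (gT (tail_product T w i))) [0..<length w]"
  have N: "?N \<lhd> Q" by (rule Q.normal_closure_normal[OF X(2)])
  interpret N: normal ?N Q by (rule N)
  have "conj_by Q (gG (fst (w ! i))) (gT (tail_product T w i)) \<in> ?N" if "i < length w" for i
  proof -
    have "fst (w ! i) \<in> carrier G" using nth_mem[OF that] letters by auto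
    then have "gG (fst (w ! i)) \<in> ?N" using X Q.normal_closure_incl by blast
    then show ?thesis
      using Q.normal_conj_by[OF N] tail_product_closed[OF letters T_product_R] by blast
  qed
  then have ps: "list_prod Q ?ps \<in> ?N" by (intro N.list_prod_closed) auto
  moreover have t: "?t \<in> carrier Q" using T_product_R R.subset by blast
  moreover have "?t \<otimes>\<^bsub>Q\<^esub> list_prod Q ?ps = \<one>\<^bsub>Q\<^esub>"
    using collect_T_letters[OF group_G group_T Q.is_group Ghat_G_hom Ghat_T_hom letters] Ghat_relation
    by simp
  ultimately have "?t = inv\<^bsub>Q\<^esub> (list_prod Q ?ps)"
    using Q.inv_equality N.subset by auto
  then show ?thesis using ps by simp
qed

text \<open>One inclusion holds because the generators of \<open>L\<close> are sent to
  \<open>R\<close> and to conjugates of \<open>G\<close>. For the other, the image of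
  \<open>K\<close> contains \<open>G\<close> and \<open>R\<close>, and it is normal:
  \<open>K\<close> is invariant under conjugation by \<open>T\<close> and by itself, and
  \<open>h\<close> is surjective.\<close>

lemma K_image:
  assumes h: "h \<in> iso K.amalgam Q" "k \<in> hom Kg Q"
    "\<And>x. x \<in> carrier T \<Longrightarrow> h (K.inl x) = gT x" "\<And>C. C \<in> carrier Kg \<Longrightarrow> h (K.inr C) = k C"
    and k: "\<And>r. r \<in> R \<Longrightarrow> k (K_inR r) = gT r"
    "\<And>y g. y \<in> cosets \<Longrightarrow> g \<in> carrier G \<Longrightarrow> k (K_inG y g) = conj_by Q (gG g) (gT (c y))"
  shows "k ` carrier Kg = normal_closure Q (gG ` carrier G \<union> gT ` R)"
proof
  let ?X = "gG ` carrier G \<union> gT ` R"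
  interpret k: group_hom Kg Q k
    using h(2) K.group_B by (simp add: group_hom_def group_hom_axioms_def)
  interpret p: group_hom L Kg "\<lambda>u. ker #>\<^bsub>L\<^esub> u" by (rule K_proj_group_hom)
  have X: "?X \<subseteq> carrier Q" using R.subset by auto
  have N: "normal_closure Q ?X \<lhd> Q" by (rule Q.normal_closure_normal[OF X])
  interpret N: normal "normal_closure Q ?X" Q by (rule N)
  have XN: "x \<in> normal_closure Q ?X" if "x \<in> ?X" for x using that Q.normal_closure_incl[OF X] by blast
  have "subgroup {u \<in> carrier L. k (ker #>\<^bsub>L\<^esub> u) \<in> normal_closure Q ?X} L"
    by (rule L.subgroupI) auto
  then have "carrier L \<subseteq> {u \<in> carrier L. k (ker #>\<^bsub>L\<^esub> u) \<in> normal_closure Q ?X}"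
  proof (rule L_generators)
    fix r assume "r \<in> R"
    then show "bar r \<in> {u \<in> carrier L. k (ker #>\<^bsub>L\<^esub> u) \<in> normal_closure Q ?X}"
      using k(1)[of r] XN by (auto simp: K_bar_def)
  next
    fix y g assume "y \<in> cosets" "g \<in> carrier G"
    then show "copy y g \<in> {u \<in> carrier L. k (ker #>\<^bsub>L\<^esub> u) \<in> normal_closure Q ?X}"
      using k(2)[of y g] Q.normal_conj_by[OF N, of "gG g" "gT (c y)"] XN coset_act(2)[OF _ T.one_closed]
      by (auto simp: K_copy_def)
  qed
  then show "k ` carrier Kg \<subseteq> normal_closure Q ?X" using K_elements by blast
  interpret h: group_hom K.amalgam Q h
    using h(1) K.group_amalgamated by (simp add: group_hom_def group_hom_axioms_def iso_def)
  interpret i: group_hom T K.amalgam K.inl by (rule inl_group_hom)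
  interpret j: group_hom Kg K.amalgam K.inr by (rule inr_group_hom)
  have "k ` carrier Kg \<lhd> Q"
  proof (rule Q.normal_invI[OF k.img_is_subgroup])
    \<comment> \<open>The inverse of \<open>z\<close>, rather than \<open>z\<close>, is written as
      the image of a product of elements of \<open>T\<close> and \<open>K\<close>. The conjugate to
      be placed in the image is then a conjugation first by \<open>x\<close> and then by
      \<open>D\<close>.\<close>
    fix z v assume z: "z \<in> carrier Q" and "v \<in> k ` carrier Kg"
    then obtain C where C: "C \<in> carrier Kg" "v = k C" by blast
    have "inv\<^bsub>Q\<^esub> z \<in> h ` carrier K.amalgam" using z h(1) by (simp add: iso_def bij_betw_def)
    then obtain p where p: "p \<in> carrier K.amalgam" "inv\<^bsub>Q\<^esub> z = h p" by blast
    obtain x D where x: "x \<in> carrier T" and D: "D \<in> carrier Kg"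
      and "p = K.inl x \<otimes>\<^bsub>K.amalgam\<^esub> K.inr D"
      using p(1) by (rule K.amalgam_elements)
    with p(2) have "inv\<^bsub>Q\<^esub> z = gT x \<otimes>\<^bsub>Q\<^esub> k D" by (simp add: h)
    then have "z = inv\<^bsub>Q\<^esub> (gT x \<otimes>\<^bsub>Q\<^esub> k D)"
      using z by (metis Q.inv_inv)
    then have "z \<otimes>\<^bsub>Q\<^esub> v \<otimes>\<^bsub>Q\<^esub> inv\<^bsub>Q\<^esub> z = conj_by Q (conj_by Q (k C) (gT x)) (k D)"
      using x D C by (simp add: Q.inv_mult_group Q.m_assoc conj_by_def)
    also have "conj_by Q (k C) (gT x) = k (K_act x C)"
      using h.conj_by_image[of "K.inr C" "K.inl x"] K.amalgam_conj[OF x C(1)] h(3,4) x C by simp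
    finally show "z \<otimes>\<^bsub>Q\<^esub> v \<otimes>\<^bsub>Q\<^esub> inv\<^bsub>Q\<^esub> z \<in> k ` carrier Kg"
      using k.conj_by_image[of "K_act x C" D] x D C by (metis K.\<phi>_closed K.B.conj_by_closed imageI)
  qed
  moreover have "?X \<subseteq> k ` carrier Kg"
  proof
    fix v assume "v \<in> ?X"
    then consider g where "g \<in> carrier G" "v = gG g" | r where "r \<in> R" "v = gT r" by blast
    then show "v \<in> k ` carrier Kg"
    proof cases
      case 1
      then have "v = k (K_inG R g)"
        using k(2)[OF R_coset] group_hom.hom_one[OF gT_group_hom] by (simp add: transversal_one conj_by_def)
      then show ?thesis using 1 copy_closed[OF R_coset] by (auto simp: K_copy_def)
    next
      case 2
      then show ?thesis using k(1)[of r] K.\<psi>_closed by (metis imageI)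
    qed
  qed
  ultimately show "normal_closure Q ?X \<subseteq> k ` carrier Kg" by (rule Q.normal_closure_minimal)
qed

end

text \<open>The lift is onto \<open>R\<close> and restricts to the inclusions on the two factors, so
  \<open>R\<close> contains \<open>A\<close> and \<open>B\<close> and is generated by them.\<close>

lemma internal_free_product_factors:
  assumes "group G" "internal_free_product G R A B"
  shows "A \<subseteq> R" and "B \<subseteq> R"
    and "subgroup H G \<Longrightarrow> A \<subseteq> H \<Longrightarrow> B \<subseteq> H \<Longrightarrow> R \<subseteq> H"
proof -
  interpret G: group G by fact
  let ?A = "G\<lparr>carrier := A\<rparr>" and ?B = "G\<lparr>carrier := B\<rparr>" and ?l = "lift G (case_sum id id)"
  have sub: "subgroup R G" "subgroup A G" "subgroup B G"
    and iso: "?l \<in> iso (free_product ?A ?B) (G\<lparr>carrier := R\<rparr>)"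
    using assms(2) by (auto simp: internal_free_product_def)
  have AB: "group ?A" "group ?B" using sub G.is_group subgroup.subgroup_is_group by blast+
  have "id \<in> hom ?A G" "id \<in> hom ?B G"
    using sub(2,3)[THEN subgroup.subset] by (auto simp: hom_def)
  note fp = lift_free_product[OF AB G.is_group this]
  interpret l: group_hom "free_product ?A ?B" G ?l
    using fp(1) group_free_product[OF AB] G.is_group by (simp add: group_hom_def group_hom_axioms_def)
  have R: "?l ` carrier (free_product ?A ?B) = R"
    using iso by (simp add: iso_def bij_betw_def)
  have inl: "free_inl ?A ?B a \<in> carrier (free_product ?A ?B)" "?l (free_inl ?A ?B a) = a" if "a \<in> A" for a
    using that fp(2) free_inl_hom[OF AB(1), of ?B] by (auto simp: hom_def)
  have inr: "free_inr ?A ?B b \<in> carrier (free_product ?A ?B)" "?l (free_inr ?A ?B b) = b" if "b \<in> B" for b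
    using that fp(3) free_inr_hom[OF AB(2), of ?A] by (auto simp: hom_def)
  show "A \<subseteq> R" unfolding R[symmetric] using inl by (metis imageI subsetI)
  show "B \<subseteq> R" unfolding R[symmetric] using inr by (metis imageI subsetI)
  assume "subgroup H G" and AH: "A \<subseteq> H" and BH: "B \<subseteq> H"
  then interpret H: subgroup H G by simp
  have "subgroup {u \<in> carrier (free_product ?A ?B). ?l u \<in> H} (free_product ?A ?B)"
    by (rule l.subgroupI) auto
  then have "carrier (free_product ?A ?B) \<subseteq> {u \<in> carrier (free_product ?A ?B). ?l u \<in> H}"
    by (rule free_product_generators[OF AB]) (use inl inr AH BH in auto)
  then show "R \<subseteq> H" unfolding R[symmetric] by blast
qed

theorem theorem3:
  fixes G :: "('g, 'm) monoid_scheme" and T :: "('t, 'n) monoid_scheme"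
    and w :: "('g \<times> 't) list" and R S :: "'t set" and c :: "'t set \<Rightarrow> 't"
    and K :: "('g, 't) L_elem set monoid" and P :: "('t \<times> ('g, 't) L_elem set) set monoid"
    and \<phi> :: "'t \<Rightarrow> ('g, 't) L_elem set \<Rightarrow> ('g, 't) L_elem set"
    and \<psi> :: "'t \<Rightarrow> ('g, 't) L_elem set"
  assumes "group G" and "group T" and "torsion_free G" and "torsion_free T"
    and "set w \<subseteq> carrier G \<times> carrier T"
    and "cyclically_reduced G T w"
    and "generalised_unimodular_with T w R S"
    and "transversal T R c"
    and "K = K_group G T R c w"
    and "\<phi> = K_action G T R c w"
    and "\<psi> = K_bar G T R c w"
    and "P = amalgamated_semidirect T K \<phi> R \<psi>"
  shows "\<exists>h\<in>iso P (Ghat G T w).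
      (\<forall>x\<in>carrier T. h (amalgam_inl T K \<phi> R \<psi> x) = Ghat_T G T w x) \<and>
      h ` (amalgam_inr T K \<phi> R \<psi> ` K_copy G T R c w R ` carrier G) = Ghat_G G T w ` carrier G \<and>
      h ` (amalgam_inr T K \<phi> R \<psi> ` carrier K)
        = normal_closure (Ghat G T w) (Ghat_G G T w ` carrier G \<union> Ghat_T G T w ` S) \<and>
      normal_closure (Ghat G T w) (Ghat_G G T w ` carrier G \<union> Ghat_T G T w ` S)
        = normal_closure (Ghat G T w) (Ghat_G G T w ` carrier G \<union> Ghat_T G T w ` R)"
proof -
  have R: "R \<lhd> T" and free: "internal_free_product T R (generate T {T_product T w}) S"
    using assms(7) by (auto simp: generalised_unimodular_with_def)
  have "generate T {T_product T w} \<subseteq> R" and S: "S \<subseteq> R"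
    using internal_free_product_factors[OF assms(2) free] by auto
  then have t: "T_product T w \<in> R" using generate.incl by fast
  interpret relator_setting G T R c w
    using assms(1,5,8) R t
    by (simp add: relator_setting_def relator_setting_axioms_def relative_setting_def)
  obtain h k where hk: "h \<in> iso K.amalgam Q" "k \<in> hom Kg Q"
    "\<And>x. x \<in> carrier T \<Longrightarrow> h (K.inl x) = gT x" "\<And>C. C \<in> carrier Kg \<Longrightarrow> h (K.inr C) = k C"
    "\<And>r. r \<in> R \<Longrightarrow> k (K_inR r) = gT r"
    "\<And>y g. y \<in> cosets \<Longrightarrow> g \<in> carrier G \<Longrightarrow> k (K_inG y g) = conj_by Q (gG g) (gT (c y))"
    by (rule amalgam_iso_Ghat) blast
  have "h (K.inr (K_inG R g)) = gG g" if g: "g \<in> carrier G" for g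
  proof -
    have "K_inG R g \<in> carrier Kg"
      using group_hom.hom_closed[OF K_proj_group_hom copy_closed[OF R_coset g]] by (simp add: K_copy_def)
    then show ?thesis
      using hk(4) hk(6)[OF R_coset g] g group_hom.hom_one[OF gT_group_hom]
      by (simp add: transversal_one conj_by_def)
  qed
  then have "h ` K.inr ` K_inG R ` carrier G = gG ` carrier G"
    by (simp add: image_image cong: image_cong)
  moreover have "h ` K.inr ` carrier Kg = normal_closure Q (gG ` carrier G \<union> gT ` R)"
    using hk(4) K_image[OF hk] by (simp add: image_image cong: image_cong)
  \<comment> \<open>The factor generated by \<open>t\<close> can be omitted: the relation already
    puts \<open>t\<close> into the normal closure of \<open>G\<close>.\<close>
  moreover have "normal_closure Q (gG ` carrier G \<union> gT ` S) = normal_closure Q (gG ` carrier G \<union> gT ` R)"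
  proof
    let ?X = "gG ` carrier G \<union> gT ` S"
    have X: "?X \<subseteq> carrier Q" using S R.subset by auto
    show "normal_closure Q ?X \<subseteq> normal_closure Q (gG ` carrier G \<union> gT ` R)"
      using S R.subset by (intro Q.normal_closure_mono) auto
    have N: "normal_closure Q ?X \<lhd> Q" by (rule Q.normal_closure_normal[OF X])
    interpret N: normal "normal_closure Q ?X" Q by (rule N)
    interpret s: group_hom T Q gT by (rule gT_group_hom)
    \<comment> \<open>The preimage of the smaller normal closure in \<open>T\<close> is a subgroup
      containing \<open>t\<close> and \<open>S\<close>; these generate \<open>R\<close>.\<close>
    let ?H = "{x \<in> carrier T. gT x \<in> normal_closure Q ?X}"
    have H: "subgroup ?H T" by (rule T.subgroupI) auto
    have "T_product T w \<in> ?H"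
      using relator_image_closure[OF _ X] t R.subset by blast
    then have "generate T {T_product T w} \<subseteq> ?H"
      by (intro T.generate_subgroup_incl[OF _ H]) simp
    moreover have "S \<subseteq> ?H" using S R.subset Q.normal_closure_incl[OF X] by blast
    ultimately have "R \<subseteq> ?H" by (rule internal_free_product_factors(3)[OF group_T free H])
    then show "normal_closure Q (gG ` carrier G \<union> gT ` R) \<subseteq> normal_closure Q ?X"
      using Q.normal_closure_incl[OF X] by (intro Q.normal_closure_minimal[OF N]) blast
  qed
  ultimately show ?thesis
    using hk(1,3) unfolding assms(9-12) by (intro bexI[of _ h]) auto
qed

end
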